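(* Let $p>2$. For $\alpha>0$ let $\mu(\alpha)$ be the bifurcation parameter for which the problem $-v''=\mu(v^p+v\sin^2 v)$ in $(0,1)$, $v>0$ in $(0,1)$, $v(0)=v(1)=0$ has a solution with $\Vert v\Vert_\infty=\alpha$. Then, as $\alpha\to\infty$, $$\mu(\alpha)=2(p+1)\alpha^{1-p}\Big\{C_{0,p}+\big(C_1+\tfrac12C_{11}\big)\alpha^{1-p}+\tfrac12(C_{12}+C_{21})\alpha^{-p}+\tfrac12C_{22}\alpha^{-(p+1)}+(C_2+C_3)\alpha^{2(1-p)}+o(\alpha^{2(1-p)})\Big\}^2,$$ where $$C_{0,p}:=\int_0^1\frac{1}{\sqrt{1-s^{p+1}}}\,ds,\qquad C_1:=-\frac{p+1}{8}\int_0^1\frac{1-s^2}{(1-s^{p+1})^{3/2}}\,ds,$$ $$C_{11}:=\frac{2}{p+1}\int_0^{\pi/2}\cos\big(2\alpha\sin^{2/(p+1)}\theta\big)\sin^{(3-p)/(p+1)}\theta\,d\theta,$$ $$C_{12}:=\frac{p-1}{2(p+1)}\int_0^{\pi/2}\big(\sin2\alpha-\sin(2\alpha\sin^{2/(p+1)}\theta)\big)\sin^{(1-p)/(p+1)}\theta\,d\theta+\frac{p+1}{4}\int_0^1\frac{1-s}{(1-s^{p+1})^{3/2}}\sin(2\alpha s)\,ds,$$ $$C_{21}:=-\frac{1}{p+1}\int_0^{\pi/2}\sin\big(2\alpha\sin^{2/(p+1)}\theta\big)\sin^{(3-p)/(p+1)}\theta\,d\theta,$$ $$C_{22}:=\frac{4(p-1)}{p+1}\int_0^{\pi/2}\big(\cos2\alpha-\cos(2\alpha\sin^{2/(p+1)}\theta)\big)\sin^{(1-p)/(p+1)}\theta\,d\theta,$$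 $$C_2:=\frac{3(p+1)^2}{128}\int_0^1\frac{(1-s^2)^2}{(1-s^{p+1})^{5/2}}\,ds,$$ $$C_3:=-\frac{3}{32}(p+1)^2\int_0^1\left(\int_0^s\frac{1-y^2}{(1-y^{p+1})^{5/2}}\,dy\right)\cos(2\alpha s)\,ds.$$
   Context: Consider, for $p>1$ and a parameter $\mu>0$, the problem $-v''(x)=\mu(v(x)^p+v(x)\sin^2v(x))$ for $x\in I:=(0,1)$, $v(x)>0$ for $x\in I$, $v(0)=v(1)=0$. It is known that for every $\alpha>0$ there is a unique pair $(\mu,v_\alpha)\in\mathbb{R}_+\times C^2(\bar I)$ solving it with $\Vert v_\alpha\Vert_\infty=\alpha$; one writes $\mu=\mu(\alpha)$, and $\mu(\alpha)$ is a continuous function of $\alpha$. The coefficients $C_{11},C_{12},C_{21},C_{22},C_3$ depend on $\alpha$ (as well as on $p$).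
   Formalization: The prefactor of C_22 is corrected from the printed 4(p-1)/(p+1) to (p-1)/(4(p+1)); as printed the expansion is false for p ≥ 3 (take α = kπ), while for 2 < p < 3 the two versions are equivalent, the difference being o(α^{2(1-p)}). *)

theory Defs
  imports "HOL-Analysis.Analysis" "HOL-Library.Landau_Symbols"
begin

text \<open>\<open>v \<in> C\<^sup>2([0,1])\<close>, with one-sided derivatives at the end points.\<close>

definition C2_with_derivs :: "(real \<Rightarrow> real) \<Rightarrow> (real \<Rightarrow> real) \<Rightarrow> (real \<Rightarrow> real) \<Rightarrow> bool" where
  "C2_with_derivs v v' v'' \<longleftrightarrow>
     (\<forall>x\<in>{0..1}. (v has_real_derivative v' x) (at x within {0..1})) \<and>
     (\<forall>x\<in>{0..1}. (v' has_real_derivative v'' x) (at x within {0..1})) \<and>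
     continuous_on {0..1} v''"

definition is_solution :: "real \<Rightarrow> real \<Rightarrow> (real \<Rightarrow> real) \<Rightarrow> bool" where
  "is_solution p \<mu> v \<longleftrightarrow>
     (\<exists>v' v''. C2_with_derivs v v' v'' \<and>
        (\<forall>x\<in>{0<..<1}. - v'' x = \<mu> * (v x powr p + v x * (sin (v x))\<^sup>2))) \<and>
     (\<forall>x\<in>{0<..<1}. v x > 0) \<and> v 0 = 0 \<and> v 1 = 0"

definition sup_norm :: "(real \<Rightarrow> real) \<Rightarrow> real" where
  "sup_norm v = (SUP x\<in>{0..1}. \<bar>v x\<bar>)"

text \<open>The integrands below may be singular at an end point of the interval of integration; there
  Isabelle's conventions \<open>x / 0 = 0\<close> and \<open>0 powr a = 0\<close> give them the value \<open>0\<close> or another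
  irrelevant finite value.  For \<open>p > 2\<close> all of the singularities are integrable, except that the
  inner integral of \<open>C3\<close> diverges at the single point \<open>s = 1\<close>.\<close>

definition C0 :: "real \<Rightarrow> real" where
  "C0 p = integral {0..1} (\<lambda>s. 1 / sqrt (1 - s powr (p + 1)))"

definition C1 :: "real \<Rightarrow> real" where
  "C1 p = - ((p + 1) / 8) * integral {0..1} (\<lambda>s. (1 - s\<^sup>2) / (1 - s powr (p + 1)) powr (3/2))"

definition C11 :: "real \<Rightarrow> real \<Rightarrow> real" where
  "C11 p \<alpha> = 2 / (p + 1) * integral {0..pi/2}
     (\<lambda>\<theta>. cos (2 * \<alpha> * sin \<theta> powr (2 / (p + 1))) * sin \<theta> powr ((3 - p) / (p + 1)))"

definition C12 :: "real \<Rightarrow> real \<Rightarrow> real" where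
  "C12 p \<alpha> =
     (p - 1) / (2 * (p + 1)) * integral {0..pi/2}
       (\<lambda>\<theta>. (sin (2 * \<alpha>) - sin (2 * \<alpha> * sin \<theta> powr (2 / (p + 1))))
              * sin \<theta> powr ((1 - p) / (p + 1)))
     + (p + 1) / 4 * integral {0..1}
       (\<lambda>s. (1 - s) / (1 - s powr (p + 1)) powr (3/2) * sin (2 * \<alpha> * s))"

definition C21 :: "real \<Rightarrow> real \<Rightarrow> real" where
  "C21 p \<alpha> = - (1 / (p + 1)) * integral {0..pi/2}
     (\<lambda>\<theta>. sin (2 * \<alpha> * sin \<theta> powr (2 / (p + 1))) * sin \<theta> powr ((3 - p) / (p + 1)))"

text \<open>The source prints the prefactor of \<open>C22\<close> as \<open>4 (p - 1) / (p + 1)\<close>.  This is a misprint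
  (the \<open>4\<close> belongs in the denominator) and makes the expansion false for \<open>p \<ge> 3\<close>.  Substituting
  \<open>s = sin \<theta> powr (2 / (p + 1))\<close> and integrating by parts against \<open>tan \<theta>\<close> gives
  \<open>(p + 1) / 8 * \<integral>\<^sub>0\<^sup>1 (cos (2\<alpha>) - cos (2\<alpha>s)) / (1 - s powr (p + 1)) powr (3/2) ds
     = \<alpha> * C21 p \<alpha> + C22 p \<alpha>\<close>
  with the prefactor used here.\<close>

definition C22 :: "real \<Rightarrow> real \<Rightarrow> real" where
  "C22 p \<alpha> = (p - 1) / (4 * (p + 1)) * integral {0..pi/2}
     (\<lambda>\<theta>. (cos (2 * \<alpha>) - cos (2 * \<alpha> * sin \<theta> powr (2 / (p + 1))))
            * sin \<theta> powr ((1 - p) / (p + 1)))"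

definition C2 :: "real \<Rightarrow> real" where
  "C2 p = 3 * (p + 1)\<^sup>2 / 128 * integral {0..1}
     (\<lambda>s. (1 - s\<^sup>2)\<^sup>2 / (1 - s powr (p + 1)) powr (5/2))"

definition C3 :: "real \<Rightarrow> real \<Rightarrow> real" where
  "C3 p \<alpha> = - (3 / 32) * (p + 1)\<^sup>2 * integral {0..1}
     (\<lambda>s. integral {0..s} (\<lambda>y. (1 - y\<^sup>2) / (1 - y powr (p + 1)) powr (5/2)) * cos (2 * \<alpha> * s))"

end

theory Submission
  imports Defs
begin

text \<open>
  The energy \<open>v'\<^sup>2 / 2 + \<mu> F(v)\<close>, with \<open>F\<close> a primitive of \<open>u powr p + u * sin(u)\<^sup>2\<close>, is constant along
  a solution. Since \<open>v\<close> is concave it increases to its maximum \<open>\<alpha>\<close> and decreases afterwards, and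
  separating variables on both monotone pieces turns the boundary conditions into
  \<open>sqrt \<mu> = sqrt 2 * \<alpha> * \<integral>\<^sub>0\<^sup>1 ds / sqrt (F \<alpha> - F (\<alpha> s))\<close> (lemma \<open>time_map\<close>).

  With \<open>F \<alpha> - F (\<alpha> s) = \<alpha> powr (p + 1) / (p + 1) * (Q s + \<delta> * H s)\<close>, where
  \<open>Q s = 1 - s powr (p + 1)\<close> (the constant \<open>power_drop\<close>), \<open>\<delta> = (p + 1) * \<alpha> powr (1 - p)\<close> and
  \<open>H s = \<integral>\<^sub>s\<^sup>1 y * sin(\<alpha> y)\<^sup>2 dy\<close> (the constant \<open>sine_drop\<close>), the amplitude
  enters through the small factor \<open>\<delta>\<close>, and \<open>0 \<le> H \<le> 1 - s \<le> Q\<close> uniformly in \<open>\<alpha>\<close>. Hence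
  the Taylor expansion of \<open>1 / sqrt (1 + x)\<close> to second order can be integrated with an error of order \<open>\<delta>\<^sup>3\<close> (lemma \<open>time_integral_expansion\<close>):

  \<^item> order zero is \<open>C0\<close>;
  \<^item> order one is \<^emph>\<open>exactly\<close> the sum of the terms with \<open>C1\<close>, \<open>C11\<close>, \<open>C12\<close>, \<open>C21\<close> and \<open>C22\<close>
    (lemma \<open>first_order_term\<close>). The differences \<open>sin (2\<alpha>) - sin (2\<alpha> s)\<close> and
    \<open>cos (2\<alpha>) - cos (2\<alpha> s)\<close> in \<open>H\<close> vary on the scale \<open>1 / \<alpha>\<close>; one integration by parts exposes
    the factor \<open>\<alpha>\<close> that this costs and weakens the singularity from \<open>Q powr (-3/2)\<close> to
    \<open>Q powr (-1/2)\<close>, and \<open>s = sin \<theta> powr (2 / (p + 1))\<close> then gives the trigonometric integrals;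
  \<^item> order two is \<open>C2 + o(1)\<close>, because \<open>sin\<^sup>2\<close> averages to \<open>1/2\<close> and so \<open>H\<close> is close to \<open>(1 - s\<^sup>2) / 4\<close>
    (lemma \<open>second_order_term\<close>). The coefficient \<open>C3\<close> is itself \<open>o(1)\<close>, an oscillatory integral of
    Riemann-Lebesgue type (lemma \<open>C3_small\<close>), so it may be added freely.

  The singularities at \<open>s = 1\<close> are all handled by one device. An oscillating quantity such as
  \<open>H - (1 - s\<^sup>2) / 4\<close> is bounded both by \<open>1 / \<alpha>\<close> and by \<open>1 - s\<close>; the weighted geometric mean
  \<open>\<alpha> powr (-1/4) * (1 - s) powr (3/4)\<close> of the two bounds gains a negative power of \<open>\<alpha>\<close> and still leaves
  an integrand dominated by the integrable weight \<open>(1 - s) powr (-3/4)\<close>.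
\<close>

section \<open>Integrals with an end point singularity\<close>

text \<open>
  The one domination argument behind every integral below. The exponent \<open>-3/4\<close> is a compromise: it is
  above \<open>-1\<close>, so the weight has total mass \<open>4\<close>, and below \<open>-1/2\<close>, the order of the singularities that
  occur, which leaves room to trade a power \<open>1/4\<close> of \<open>1 - s\<close> for a power of \<open>1 / \<alpha>\<close>.
\<close>

lemma weight_integrable:
  fixes f :: "real \<Rightarrow> real"
  assumes cont: "continuous_on {0..<1} f"
    and bound: "\<And>s. s \<in> {0..<1} \<Longrightarrow> \<bar>f s\<bar> \<le> C * (1 - s) powr (-3/4)"
  shows "f integrable_on {0..1}" and "\<bar>integral {0..1} f\<bar> \<le> 4 * C"
proof -
  have F: "((\<lambda>s::real. (1 - s) powr (-3/4)) has_integral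
      (- 4 * (1 - 1) powr (1/4)) - (- 4 * (1 - 0) powr (1/4))) {0..1}"
  proof (rule fundamental_theorem_of_calculus_interior)
    show "continuous_on {0..1} (\<lambda>s::real. - 4 * (1 - s) powr (1/4))"
      by (intro continuous_intros continuous_on_powr') auto
    show "((\<lambda>s. - 4 * (1 - s) powr (1/4)) has_vector_derivative (1 - x) powr (-3/4)) (at x)"
      if "x \<in> {0<..<1}" for x :: real
      unfolding has_real_derivative_iff_has_vector_derivative[symmetric]
      using that by (auto intro!: derivative_eq_intros)
  qed auto
  have E: "(h has_integral y) {0..<1} \<longleftrightarrow> (h has_integral y) {0..1}" for h :: "real \<Rightarrow> real" and y
    by (rule has_integral_spike_set_eq; rule negligible_subset[of "{1}"]) auto
  have F': "((\<lambda>s::real. C * (1 - s) powr (-3/4)) has_integral C * 4) {0..<1}"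
    unfolding E using has_integral_mult_right[OF F, of C] by simp
  have I: "f integrable_on {0..<1}"
  proof (rule measurable_bounded_by_integrable_imp_integrable)
    show "f \<in> borel_measurable (lebesgue_on {0..<1})"
      by (rule continuous_imp_measurable_on_sets_lebesgue[OF cont]) auto
    show "(\<lambda>s::real. C * (1 - s) powr (-3/4)) integrable_on {0..<1}" using F' by blast
    show "norm (f x) \<le> C * (1 - x) powr (-3/4)" if "x \<in> {0..<1}" for x
      using bound[OF that] by simp
  qed auto
  show "f integrable_on {0..1}" using I E[of f] by (simp add: integrable_on_def)
  have "integral {0..<1} f = integral {0..1} f"
    by (rule integral_unique[OF iffD1[OF E integrable_integral[OF I]], symmetric])
  moreover have "norm (integral {0..<1} f) \<le> integral {0..<1} (\<lambda>s. C * (1 - s) powr (-3/4))"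
    by (rule integral_norm_bound_integral[OF I has_integral_integrable[OF F']]) (use bound in auto)
  ultimately show "\<bar>integral {0..1} f\<bar> \<le> 4 * C"
    unfolding integral_unique[OF F'] by simp
qed

text \<open>Used with \<open>a = 1 / \<alpha>\<close>, small for large amplitudes, and \<open>b = 1 - s\<close>, small near the singularity.\<close>

lemma min_le_weighted:
  assumes "0 \<le> x" "x \<le> a" "x \<le> b" "0 \<le> (t::real)" "t \<le> 1"
  shows "x \<le> a powr (1 - t) * b powr t"
proof -
  have "x = x powr (1 - t) * x powr t" using assms by (simp flip: powr_add)
  also have "\<dots> \<le> a powr (1 - t) * b powr t"
    using assms by (intro mult_mono powr_mono2) auto
  finally show ?thesis .
qed

section \<open>The drops of the two parts of the potential\<close>

text \<open>The drop of \<open>u powr (p + 1) / (p + 1)\<close> from \<open>u = \<alpha>\<close> to \<open>u = \<alpha> s\<close>, divided by its value at \<open>u = \<alpha>\<close>.\<close>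

definition power_drop :: "real \<Rightarrow> real \<Rightarrow> real" where
  "power_drop p s = 1 - s powr (p + 1)"

lemma power_drop_lower:
  assumes "1 \<le> p" "0 \<le> s" "s \<le> 1"
  shows "1 - s \<le> power_drop p s"
proof -
  have "s powr (p + 1) \<le> s powr 1" using assms by (intro powr_mono') auto
  then show ?thesis using assms by (simp add: power_drop_def)
qed

lemma power_drop_pos: "1 \<le> p \<Longrightarrow> 0 \<le> s \<Longrightarrow> s < 1 \<Longrightarrow> 0 < power_drop p s"
  using power_drop_lower[of p s] by simp

lemma power_drop_one [simp]: "power_drop p 1 = 0"
  by (simp add: power_drop_def)

lemma continuous_on_power_drop: "1 \<le> p \<Longrightarrow> S \<subseteq> {0..} \<Longrightarrow> continuous_on S (power_drop p)"
  unfolding power_drop_def by (intro continuous_intros continuous_on_powr') auto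

lemma power_drop_deriv:
  "0 < s \<Longrightarrow> (power_drop p has_real_derivative - (p + 1) * s powr p) (at s)"
  unfolding power_drop_def by (auto intro!: derivative_eq_intros simp: algebra_simps)

text \<open>
  Counting powers of \<open>1 - s\<close>: a numerator of order \<open>j\<close> over \<open>power_drop powr e\<close> has order at least
  \<open>j - e\<close>, and this must not be below \<open>-3/4\<close>.
\<close>

lemma power_drop_quotient_integral:
  assumes p: "1 \<le> p" and f: "continuous_on {0..<1} f"
    and bound: "\<And>s. s \<in> {0..<1} \<Longrightarrow> \<bar>f s\<bar> \<le> C * (1 - s) powr j"
    and e: "0 \<le> e" "e \<le> j + 3/4"
  shows "(\<lambda>s. f s / power_drop p s powr e) integrable_on {0..1}"
    and "\<bar>integral {0..1} (\<lambda>s. f s / power_drop p s powr e)\<bar> \<le> 4 * C"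
proof -
  have C: "0 \<le> C" using bound[of 0] by simp
  have c: "continuous_on {0..<1} (\<lambda>s. f s / power_drop p s powr e)"
    by (intro continuous_intros f continuous_on_power_drop p) (use power_drop_pos[OF p] in force)+
  have b: "\<bar>f s / power_drop p s powr e\<bar> \<le> C * (1 - s) powr (-3/4)" if s: "s \<in> {0..<1}" for s
  proof -
    have "\<bar>f s / power_drop p s powr e\<bar> \<le> C * (1 - s) powr j / (1 - s) powr e"
      unfolding abs_divide
      by (rule frac_le) (use s bound[OF s] C power_drop_lower[OF p, of s] e in \<open>auto intro!: powr_mono2\<close>)
    also have "\<dots> = C * (1 - s) powr (j - e)" using s by (simp add: powr_diff)
    also have "\<dots> \<le> C * (1 - s) powr (-3/4)"
      using s C e by (intro mult_left_mono powr_mono') auto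
    finally show ?thesis .
  qed
  show "(\<lambda>s. f s / power_drop p s powr e) integrable_on {0..1}" by (rule weight_integrable(1)[OF c b])
  show "\<bar>integral {0..1} (\<lambda>s. f s / power_drop p s powr e)\<bar> \<le> 4 * C" by (rule weight_integrable(2)[OF c b])
qed

text \<open>
  This is \<open>\<integral>\<^sub>s\<^sup>1 y * sin(\<alpha> y)\<^sup>2 dy\<close>, that is, \<open>\<alpha> powr (-2)\<close> times the drop of the primitive of
  \<open>u * sin(u)\<^sup>2\<close> from \<open>u = \<alpha>\<close> to \<open>u = \<alpha> s\<close>. The closed form is used because it separates the mean value
  \<open>(1 - s\<^sup>2) / 4\<close> from the oscillations.
\<close>

definition sine_drop :: "real \<Rightarrow> real \<Rightarrow> real" where
  "sine_drop \<alpha> s = (1 - s\<^sup>2) / 4 - (sin (2 * \<alpha>) - s * sin (2 * \<alpha> * s)) / (4 * \<alpha>)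
           - (cos (2 * \<alpha>) - cos (2 * \<alpha> * s)) / (8 * \<alpha>\<^sup>2)"

lemma sine_drop_one [simp]: "sine_drop \<alpha> 1 = 0"
  by (simp add: sine_drop_def)

lemma sine_drop_deriv:
  assumes "0 < \<alpha>"
  shows "(sine_drop \<alpha> has_real_derivative - s * (sin (\<alpha> * s))\<^sup>2) (at s)"
proof -
  have "(sine_drop \<alpha> has_real_derivative - s * ((1 - cos (2 * \<alpha> * s)) / 2)) (at s)"
    unfolding sine_drop_def using assms
    by (auto intro!: derivative_eq_intros simp: field_simps power2_eq_square)
  moreover have "(1 - cos (2 * \<alpha> * s)) / 2 = (sin (\<alpha> * s))\<^sup>2"
    using cos_double_sin[of "\<alpha> * s"] by (simp add: mult.assoc)
  ultimately show ?thesis by simp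
qed

lemma continuous_on_sine_drop: "0 < \<alpha> \<Longrightarrow> continuous_on S (sine_drop \<alpha>)"
  unfolding sine_drop_def by (intro continuous_intros) auto

lemma sine_drop_nonneg:
  assumes "0 < \<alpha>" "0 \<le> s" "s \<le> 1"
  shows "0 \<le> sine_drop \<alpha> s"
proof -
  have "sine_drop \<alpha> 1 \<le> sine_drop \<alpha> s"
    by (rule DERIV_nonpos_imp_nonincreasing[OF assms(3)])
       (use assms sine_drop_deriv in \<open>fastforce intro: mult_nonpos_nonneg\<close>)
  then show ?thesis by simp
qed

lemma sine_drop_upper:
  assumes "0 < \<alpha>" "0 \<le> s" "s \<le> 1"
  shows "sine_drop \<alpha> s \<le> (1 - s\<^sup>2) / 2"
proof -
  have "sine_drop \<alpha> s - (1 - s\<^sup>2) / 2 \<le> sine_drop \<alpha> 1 - (1 - 1\<^sup>2) / 2"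
  proof (rule DERIV_nonneg_imp_nondecreasing[OF assms(3)])
    fix x assume x: "s \<le> x" "x \<le> 1"
    have "((\<lambda>s. sine_drop \<alpha> s - (1 - s\<^sup>2) / 2) has_real_derivative x * (1 - (sin (\<alpha> * x))\<^sup>2)) (at x)"
      by (auto intro!: derivative_eq_intros sine_drop_deriv assms simp: algebra_simps)
    moreover have "0 \<le> x * (1 - (sin (\<alpha> * x))\<^sup>2)"
      using x assms by (auto intro!: mult_nonneg_nonneg simp: abs_square_le_1)
    ultimately show "\<exists>y. ((\<lambda>s. sine_drop \<alpha> s - (1 - s\<^sup>2) / 2) has_real_derivative y) (at x) \<and> 0 \<le> y"
      by blast
  qed
  then show ?thesis by simp
qed

lemma one_minus_square:
  fixes s :: real
  assumes "0 \<le> s" "s \<le> 1"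
  shows "0 \<le> 1 - s\<^sup>2" and "1 - s\<^sup>2 \<le> 2 * (1 - s)"
proof -
  have "1 - s\<^sup>2 = (1 + s) * (1 - s)" by (simp add: algebra_simps power2_eq_square)
  moreover have "(1 + s) * (1 - s) \<le> 2 * (1 - s)" using assms by (intro mult_right_mono) auto
  ultimately show "0 \<le> 1 - s\<^sup>2" and "1 - s\<^sup>2 \<le> 2 * (1 - s)" using assms by simp_all
qed

text \<open>
  The oscillating part of \<open>sine_drop\<close> is \<open>O(1 / \<alpha>)\<close> by its closed form, and \<open>O(1 - s)\<close> because
  \<open>sine_drop\<close> and its mean value both are.
\<close>

lemma sine_drop_average:
  assumes "1 \<le> \<alpha>" "0 \<le> s" "s \<le> 1"
  shows "\<bar>sine_drop \<alpha> s - (1 - s\<^sup>2) / 4\<bar> \<le> \<alpha> powr (-1/4) * (1 - s) powr (3/4)"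
proof -
  let ?D = "sine_drop \<alpha> s - (1 - s\<^sup>2) / 4"
  have "\<bar>?D\<bar> \<le> 1 - s"
    using one_minus_square[of s] sine_drop_nonneg[of \<alpha> s] sine_drop_upper[of \<alpha> s] assms
    unfolding abs_le_iff by argo
  moreover have "\<bar>?D\<bar> \<le> 1 / \<alpha>"
  proof -
    have "\<bar>sin (2 * \<alpha>) - s * sin (2 * \<alpha> * s)\<bar> \<le> \<bar>sin (2 * \<alpha>)\<bar> + \<bar>s * sin (2 * \<alpha> * s)\<bar>" by simp
    also have "\<dots> \<le> 1 + 1 * 1" unfolding abs_mult
      using assms by (intro add_mono mult_mono) auto
    finally have 1: "\<bar>sin (2 * \<alpha>) - s * sin (2 * \<alpha> * s)\<bar> \<le> 2" by simp
    have 2: "\<bar>cos (2 * \<alpha>) - cos (2 * \<alpha> * s)\<bar> \<le> 2"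
      using cos_le_one[of "2*\<alpha>"] cos_ge_minus_one[of "2*\<alpha>"]
        cos_le_one[of "2 * \<alpha> * s"] cos_ge_minus_one[of "2 * \<alpha> * s"] by linarith
    have "?D = - ((sin (2 * \<alpha>) - s * sin (2 * \<alpha> * s)) / (4 * \<alpha>)
             + (cos (2 * \<alpha>) - cos (2 * \<alpha> * s)) / (8 * \<alpha>\<^sup>2))" by (simp add: sine_drop_def)
    then have "\<bar>?D\<bar> \<le> \<bar>(sin (2 * \<alpha>) - s * sin (2 * \<alpha> * s)) / (4 * \<alpha>)\<bar>
        + \<bar>(cos (2 * \<alpha>) - cos (2 * \<alpha> * s)) / (8 * \<alpha>\<^sup>2)\<bar>"
      by (metis abs_minus_cancel abs_triangle_ineq)
    also have "\<dots> \<le> 2 / (4 * \<alpha>) + 2 / (8 * \<alpha>\<^sup>2)"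
      unfolding abs_divide by (intro add_mono frac_le) (use assms 1 2 in auto)
    also have "\<dots> \<le> 1 / \<alpha>" using assms by (simp add: field_simps power2_eq_square)
    finally show ?thesis .
  qed
  ultimately have "\<bar>?D\<bar> \<le> (1 / \<alpha>) powr (1 - 3/4) * (1 - s) powr (3/4)"
    by (intro min_le_weighted) auto
  then show ?thesis using assms by (simp add: powr_divide powr_minus_divide)
qed

section \<open>Substitution and integration by parts\<close>

text \<open>
  Substitution for an integrand that is singular at the end points. The primitive of \<open>g\<close> is still
  continuous on the closed interval, so the fundamental theorem of calculus applies to its composition
  with \<open>w\<close>, and integrability of \<open>g \<circ> w\<close> times \<open>w'\<close> is part of the conclusion. It serves the change
  of variable \<open>s = sin \<theta> powr (2 / (p + 1))\<close> and, with \<open>w\<close> a solution of the differential equation,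
  the separation of variables.
\<close>

lemma integral_substitution_interior:
  fixes g w w' :: "real \<Rightarrow> real"
  assumes "a \<le> b" and w: "continuous_on {a..b} w" "w ` {a..b} \<subseteq> {0..1}"
    and pos: "\<And>x. x \<in> {a<..<b} \<Longrightarrow> 0 < w x \<and> w x < 1"
    and w': "\<And>x. x \<in> {a<..<b} \<Longrightarrow> (w has_real_derivative w' x) (at x)"
    and g: "g integrable_on {0..1}" "continuous_on {0<..<1} g"
  shows "((\<lambda>x. g (w x) * w' x) has_integral
     (integral {0..w b} g - integral {0..w a} g)) {a..b}"
proof (rule fundamental_theorem_of_calculus_interior)
  show "continuous_on {a..b} (\<lambda>x. integral {0..w x} g)"
    by (rule continuous_on_compose2[OF indefinite_integral_continuous_1[OF g(1)] w])
  show "((\<lambda>x. integral {0..w x} g) has_vector_derivative g (w x) * w' x) (at x)"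
    if x: "x \<in> {a<..<b}" for x
  proof -
    have wx: "w x \<in> {0<..<1}" using pos[OF x] by simp
    have "isCont g (w x)" using g(2) wx by (simp add: continuous_on_eq_continuous_at)
    then have "((\<lambda>u. integral {0..u} g) has_vector_derivative g (w x)) (at (w x) within {0..1})"
      using integral_has_vector_derivative_continuous_at[OF g(1), of "w x" "{}"] wx
      by (auto intro: continuous_at_imp_continuous_at_within)
    then have "((\<lambda>u. integral {0..u} g) has_real_derivative g (w x)) (at (w x))"
      using wx by (simp add: has_real_derivative_iff_has_vector_derivative at_within_Icc_at)
    from DERIV_chain2[OF this w'[OF x]] show ?thesis
      by (simp add: has_real_derivative_iff_has_vector_derivative)
  qed
qed fact

lemma sqrt_weight_tendsto: "((\<lambda>s::real. L * (1 - s) powr (1/2)) \<longlongrightarrow> 0) (at 1 within {0..1})"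
proof -
  have "continuous_on {0..1} (\<lambda>s::real. L * (1 - s) powr (1/2))"
    by (intro continuous_intros continuous_on_powr') auto
  from this[unfolded continuous_on_def, THEN bspec, of 1] show ?thesis by simp
qed

text \<open>
  The function \<open>s * g s / power_drop p s powr (1/2)\<close> vanishes at both end points, at \<open>s = 1\<close> because
  \<open>g\<close> does so to first order. Its derivative contains the term
  \<open>(p + 1) / 2 * s powr (p + 1) * g s / power_drop p s powr (3/2)\<close>, and
  \<open>s powr (p + 1) = 1 - power_drop p s\<close> splits it into the integrands of exponents \<open>3/2\<close> and \<open>1/2\<close>.
\<close>

lemma integration_by_parts_power_drop:
  fixes g g' :: "real \<Rightarrow> real"
  assumes p: "1 \<le> p" and g: "\<And>s. (g has_real_derivative g' s) (at s)"
    and g': "continuous_on {0..1} g'" "\<And>s. \<bar>g' s\<bar> \<le> L" and "g 1 = 0"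
  shows "integral {0..1} (\<lambda>s. g s / power_drop p s powr (3/2))
     = (p - 1) / (p + 1) * integral {0..1} (\<lambda>s. g s / power_drop p s powr (1/2))
       - 2 / (p + 1) * integral {0..1} (\<lambda>s. s * g' s / power_drop p s powr (1/2))"
proof -
  have gL: "\<bar>g s\<bar> \<le> L * (1 - s)" if "s \<in> {0..1}" for s
  proof -
    have "norm (g s - g 1) \<le> L * norm (s - 1)"
      by (rule field_differentiable_bound[of "UNIV"])
         (use g g'(2) in \<open>auto intro: has_field_derivative_at_within\<close>)
    then show ?thesis using that \<open>g 1 = 0\<close> by auto
  qed
  have L: "0 \<le> L" using g'(2)[of 0] by simp
  have gc: "continuous_on S g" for S
    using g by (auto intro!: continuous_at_imp_continuous_on DERIV_isCont)
  have g'c: "continuous_on {0..<1} g'" by (rule continuous_on_subset[OF g'(1)]) auto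
  have i3: "(\<lambda>s. g s / power_drop p s powr (3/2)) integrable_on {0..1}"
    by (rule power_drop_quotient_integral(1)[OF p gc, where C = L and j = 1]) (use gL in auto)
  have i1: "(\<lambda>s. g s / power_drop p s powr (1/2)) integrable_on {0..1}"
    by (rule power_drop_quotient_integral(1)[OF p gc, where C = L and j = 1]) (use gL in auto)
  have i2: "(\<lambda>s. s * g' s / power_drop p s powr (1/2)) integrable_on {0..1}"
  proof (rule power_drop_quotient_integral(1)[OF p, where C = L and j = 0])
    show "continuous_on {0..<1} (\<lambda>s. s * g' s)" by (intro continuous_intros g'c)
    show "\<bar>s * g' s\<bar> \<le> L * (1 - s) powr 0" if "s \<in> {0..<1}" for s
    proof -
      have "\<bar>s\<bar> * \<bar>g' s\<bar> \<le> 1 * L" using that g'(2)[of s] by (intro mult_mono) auto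
      then show ?thesis using that by (simp add: abs_mult)
    qed
  qed auto
  let ?\<Psi> = "\<lambda>s. s * g s / power_drop p s powr (1/2)"
  let ?\<psi> = "\<lambda>s. (1 - p) / 2 * (g s / power_drop p s powr (1/2)) + s * g' s / power_drop p s powr (1/2)
     + (p + 1) / 2 * (g s / power_drop p s powr (3/2))"
  have "(?\<psi> has_integral (?\<Psi> 1 - ?\<Psi> 0)) {0..1}"
  proof (rule fundamental_theorem_of_calculus_interior)
    show "continuous_on {0..1} ?\<Psi>"
      unfolding continuous_on_eq_continuous_within
    proof
      fix x :: real assume x: "x \<in> {0..1}"
      show "continuous (at x within {0..1}) ?\<Psi>"
      proof (cases "x = 1")
        case False
        then have Qx: "power_drop p x \<noteq> 0" using power_drop_pos[OF p, of x] x by auto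
        have "continuous (at x within {0..1}) (power_drop p)" "continuous (at x within {0..1}) g"
          using continuous_on_power_drop[OF p, of "{0..1}"] gc[of "{0..1}"] x
          by (auto simp: continuous_on_eq_continuous_within)
        then show ?thesis using Qx by (intro continuous_intros) auto
      next
        case True
        have "norm (?\<Psi> s) \<le> L * (1 - s) powr (1/2)" if s: "s \<in> {0..1}" "s \<noteq> 1" for s
        proof -
          have "\<bar>s\<bar> * \<bar>g s\<bar> \<le> 1 * (L * (1 - s))" using s gL[OF s(1)] by (intro mult_mono) auto
          then have "norm (?\<Psi> s) \<le> L * (1 - s) / (1 - s) powr (1/2)"
            unfolding real_norm_def abs_divide abs_mult
            by (intro frac_le) (use s L power_drop_lower[OF p, of s] in \<open>auto intro!: powr_mono2\<close>)
          also have "\<dots> = L * ((1 - s) powr 1 / (1 - s) powr (1/2))" using s by simp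
          also have "\<dots> = L * (1 - s) powr (1/2)"
            by (subst powr_diff[symmetric]) simp
          finally show ?thesis .
        qed
        then have "\<forall>\<^sub>F s in at 1 within {0..1}. norm (?\<Psi> s) \<le> L * (1 - s) powr (1/2)"
          unfolding eventually_at_filter by (intro always_eventually) blast
        from Lim_null_comparison[OF this sqrt_weight_tendsto]
        have "(?\<Psi> \<longlongrightarrow> 0) (at 1 within {0..1})" .
        then show ?thesis using True by (simp add: continuous_within)
      qed
    qed
    show "(?\<Psi> has_vector_derivative ?\<psi> x) (at x)" if x: "x \<in> {0<..<1}" for x
    proof -
      define q where "q = power_drop p x powr (1/2)"
      have Q: "0 < power_drop p x" using power_drop_pos[OF p, of x] x by simp
      then have q: "0 < q" by (simp add: q_def)
      have Qq: "power_drop p x = q\<^sup>2" "power_drop p x powr (3/2) = q ^ 3"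
        using Q unfolding q_def by (simp_all add: powr_power powr_powr)
      have xp: "x * x powr p = 1 - q\<^sup>2"
        using x unfolding Qq(1)[symmetric] power_drop_def by (simp add: powr_add)
      have "((\<lambda>s. power_drop p s powr (1/2)) has_real_derivative
          1/2 * power_drop p x powr (1/2 - 1) * (- (p + 1) * x powr p)) (at x)"
        using DERIV_fun_powr[OF power_drop_deriv Q, of "1/2"] x by simp
      moreover have "power_drop p x powr (1/2 - 1) = 1 / q"
        unfolding q_def by (simp add: powr_minus_divide)
      ultimately have "((\<lambda>s. power_drop p s powr (1/2)) has_real_derivative
          - (p + 1) * x powr p / (2 * q)) (at x)" by (simp add: mult.commute)
      from DERIV_divide[OF DERIV_mult[OF DERIV_ident g] this]
      have "(?\<Psi> has_real_derivative
          ((1 * g x + g' x * x) * q - x * g x * (- (p + 1) * x powr p / (2 * q))) / (q * q)) (at x)"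
        using q unfolding q_def by simp
      also have "((1 * g x + g' x * x) * q - x * g x * (- (p + 1) * x powr p / (2 * q))) / (q * q)
          = ((g x + g' x * x) * q + (p + 1) * g x * (x * x powr p) / (2 * q)) / (q * q)"
        using q by (simp add: field_simps)
      also have "\<dots> = (1 - p) / 2 * (g x / q) + x * g' x / q + (p + 1) / 2 * (g x / q ^ 3)"
        unfolding xp using q by (simp add: field_simps power2_eq_square power3_eq_cube)
      finally show ?thesis
        unfolding has_real_derivative_iff_has_vector_derivative Qq(2) q_def .
    qed
  qed simp
  moreover have "(?\<psi> has_integral ((1 - p) / 2 * integral {0..1} (\<lambda>s. g s / power_drop p s powr (1/2))
     + integral {0..1} (\<lambda>s. s * g' s / power_drop p s powr (1/2))
     + (p + 1) / 2 * integral {0..1} (\<lambda>s. g s / power_drop p s powr (3/2)))) {0..1}"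
    by (intro has_integral_add has_integral_mult_right integrable_integral i1 i2 i3)
  ultimately have "?\<Psi> 1 - ?\<Psi> 0 = (1 - p) / 2 * integral {0..1} (\<lambda>s. g s / power_drop p s powr (1/2))
     + integral {0..1} (\<lambda>s. s * g' s / power_drop p s powr (1/2))
     + (p + 1) / 2 * integral {0..1} (\<lambda>s. g s / power_drop p s powr (3/2))"
    by (rule has_integral_unique)
  then have "(p + 1) * integral {0..1} (\<lambda>s. g s / power_drop p s powr (3/2))
     = (p - 1) * integral {0..1} (\<lambda>s. g s / power_drop p s powr (1/2))
       - 2 * integral {0..1} (\<lambda>s. s * g' s / power_drop p s powr (1/2))"
    by (simp add: field_simps)
  then have "integral {0..1} (\<lambda>s. g s / power_drop p s powr (3/2))
     = ((p - 1) * integral {0..1} (\<lambda>s. g s / power_drop p s powr (1/2))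
       - 2 * integral {0..1} (\<lambda>s. s * g' s / power_drop p s powr (1/2))) / (p + 1)"
    using p by (simp add: eq_divide_eq mult.commute)
  then show ?thesis by (subst (asm) diff_divide_distrib) simp
qed

lemma sine_substitution:
  fixes k :: "real \<Rightarrow> real"
  assumes p: "1 \<le> p" and k: "continuous_on {0..1} k"
  shows "integral {0..pi/2} (\<lambda>\<theta>. k (sin \<theta> powr (2 / (p + 1))) * sin \<theta> powr ((1 - p) / (p + 1)))
     = (p + 1) / 2 * integral {0..1} (\<lambda>s. k s / power_drop p s powr (1/2))"
proof -
  obtain C where C: "\<bar>k s\<bar> \<le> C" if "s \<in> {0..1}" for s
    using compact_continuous_image[OF k compact_Icc]
    by (force dest!: compact_imp_bounded simp: bounded_iff)
  let ?g = "\<lambda>s. k s / power_drop p s powr (1/2)"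
  let ?w = "\<lambda>\<theta>. sin \<theta> powr (2 / (p + 1))"
  let ?w' = "\<lambda>\<theta>. 2 / (p + 1) * sin \<theta> powr ((1 - p) / (p + 1)) * cos \<theta>"
  have g: "?g integrable_on {0..1}"
    by (rule power_drop_quotient_integral(1)[OF p, where C = C and j = 0])
       (use C in \<open>auto intro: continuous_on_subset[OF k]\<close>)
  have "power_drop p s \<noteq> 0" if "s \<in> {0<..<1}" for s using power_drop_pos[OF p, of s] that by auto
  then have gc: "continuous_on {0<..<1} ?g"
    by (intro continuous_intros continuous_on_subset[OF k] continuous_on_power_drop[OF p]) auto
  have sc: "0 < sin \<theta> \<and> sin \<theta> < 1 \<and> 0 < cos \<theta>" if "\<theta> \<in> {0<..<pi/2}" for \<theta>
  proof -
    have c: "0 < cos \<theta>" "0 < sin \<theta>" using that by (auto intro!: cos_gt_zero sin_gt_zero)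
    have "sin \<theta> \<noteq> 1" using c cos_squared_eq[of \<theta>] by force
    then show ?thesis using c sin_le_one[of \<theta>] by linarith
  qed
  have sub: "((\<lambda>\<theta>. ?g (?w \<theta>) * ?w' \<theta>) has_integral
      (integral {0..?w (pi/2)} ?g - integral {0..?w 0} ?g)) {0..pi/2}"
  proof (rule integral_substitution_interior[OF _ _ _ _ _ g gc])
    show "continuous_on {0..pi/2} ?w"
      using p by (intro continuous_intros continuous_on_powr') (auto simp: sin_ge_zero)
    show "?w ` {0..pi/2} \<subseteq> {0..1}"
      using p by (auto intro!: powr_le1 simp: sin_ge_zero)
    show "0 < ?w x \<and> ?w x < 1" if "x \<in> {0<..<pi/2}" for x
      using sc[OF that] p powr_less_mono2[of "2/(p+1)" "sin x" 1] by auto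
    show "(?w has_real_derivative ?w' x) (at x)" if "x \<in> {0<..<pi/2}" for x
    proof -
      have "2 / (p + 1) - 1 = (1 - p) / (p + 1)" using p by (simp add: field_simps)
      then show ?thesis using sc[OF that] p
        by (auto intro!: derivative_eq_intros)
    qed
  qed auto
  have "((\<lambda>\<theta>. 2 / (p + 1) * (k (?w \<theta>) * sin \<theta> powr ((1 - p) / (p + 1)))) has_integral
      (integral {0..1} ?g)) {0..pi/2}"
  proof -
    have "?g (?w \<theta>) * ?w' \<theta> = 2 / (p + 1) * (k (?w \<theta>) * sin \<theta> powr ((1 - p) / (p + 1)))"
      if "\<theta> \<in> box 0 (pi/2)" for \<theta>
    proof -
      have \<theta>: "0 < sin \<theta>" "0 < cos \<theta>" using sc that by auto
      have "2 / (p + 1) * (p + 1) = 2" using p by (simp add: field_simps)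
      then have "?w \<theta> powr (p + 1) = (sin \<theta>)\<^sup>2" using \<theta> by (simp only: powr_powr powr_numeral)
      then have "power_drop p (?w \<theta>) = (cos \<theta>)\<^sup>2" unfolding power_drop_def by (simp add: cos_squared_eq)
      then have "power_drop p (?w \<theta>) powr (1/2) = cos \<theta>" using \<theta> by (simp add: powr_half_sqrt)
      then show ?thesis using \<theta> by simp
    qed
    from has_integral_spike_interior_eq[of 0 "pi/2", OF this] sub show ?thesis using p by simp
  qed
  from integral_unique[OF this] show ?thesis using p by (simp add: field_simps)
qed

section \<open>The first order term\<close>

text \<open>
  An identity, valid for every amplitude. By the closed form of \<open>sine_drop\<close> the integral is
  \<open>A / 4 - (As + B) / (4 \<alpha>) - Ac / (8 \<alpha>\<^sup>2)\<close>; here \<open>sin (2\<alpha>) - s * sin (2\<alpha> s)\<close> is written as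
  \<open>(sin (2\<alpha>) - sin (2\<alpha> s)) + (1 - s) * sin (2\<alpha> s)\<close>, so that the first difference vanishes at \<open>s = 1\<close> and can be
  integrated by parts. In \<open>As\<close> and \<open>Ac\<close> the derivatives \<open>gs'\<close> and \<open>gc'\<close> produce a factor \<open>\<alpha>\<close>, which is why
  \<open>C11\<close> moves from order \<open>\<alpha> powr (- p)\<close> to \<open>\<alpha> powr (1 - p)\<close>, and \<open>C21\<close> from
  \<open>\<alpha> powr (- (p + 1))\<close> to \<open>\<alpha> powr (- p)\<close>.
\<close>

lemma first_order_term:
  assumes p: "1 \<le> p" and \<alpha>: "0 < \<alpha>"
  shows "- ((p + 1) / 2) * \<alpha> powr (1 - p) * integral {0..1} (\<lambda>s. sine_drop \<alpha> s / power_drop p s powr (3/2))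
     = (C1 p + 1/2 * C11 p \<alpha>) * \<alpha> powr (1 - p)
        + 1/2 * (C12 p \<alpha> + C21 p \<alpha>) * \<alpha> powr (- p)
        + 1/2 * C22 p \<alpha> * \<alpha> powr (- (p + 1))"
proof -
  define gs where "gs = (\<lambda>s. sin (2 * \<alpha>) - sin (2 * \<alpha> * s))"
  define gc where "gc = (\<lambda>s. cos (2 * \<alpha>) - cos (2 * \<alpha> * s))"
  define A where "A = integral {0..1} (\<lambda>s. (1 - s\<^sup>2) / power_drop p s powr (3/2))"
  define B where "B = integral {0..1} (\<lambda>s. (1 - s) * sin (2 * \<alpha> * s) / power_drop p s powr (3/2))"
  define As where "As = integral {0..1} (\<lambda>s. gs s / power_drop p s powr (3/2))"
  define Ac where "Ac = integral {0..1} (\<lambda>s. gc s / power_drop p s powr (3/2))"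
  define Bs where "Bs = integral {0..1} (\<lambda>s. gs s / power_drop p s powr (1/2))"
  define Bc where "Bc = integral {0..1} (\<lambda>s. gc s / power_drop p s powr (1/2))"
  define Ds where "Ds = integral {0..1} (\<lambda>s. s * sin (2 * \<alpha> * s) / power_drop p s powr (1/2))"
  define Dc where "Dc = integral {0..1} (\<lambda>s. s * cos (2 * \<alpha> * s) / power_drop p s powr (1/2))"
  have ds: "(gs has_real_derivative - 2 * \<alpha> * cos (2 * \<alpha> * s)) (at s)" for s
    unfolding gs_def by (auto intro!: derivative_eq_intros)
  have dc: "(gc has_real_derivative 2 * \<alpha> * sin (2 * \<alpha> * s)) (at s)" for s
    unfolding gc_def by (auto intro!: derivative_eq_intros)
  have lip: "\<bar>g s\<bar> \<le> 2 * \<alpha> * (1 - s)"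
    if g: "\<And>s. (g has_real_derivative g' s) (at s)" "\<And>s. \<bar>g' s\<bar> \<le> 2 * \<alpha>" "g 1 = 0"
      and s: "s \<in> {0..<1}" for g g' :: "real \<Rightarrow> real" and s
  proof -
    have "norm (g s - g 1) \<le> 2 * \<alpha> * norm (s - 1)"
      by (rule field_differentiable_bound[of "UNIV"])
         (use g in \<open>auto intro: has_field_derivative_at_within\<close>)
    then show ?thesis using s g by auto
  qed
  have bs: "\<bar>- 2 * \<alpha> * cos (2 * \<alpha> * s)\<bar> \<le> 2 * \<alpha>" and bc: "\<bar>2 * \<alpha> * sin (2 * \<alpha> * s)\<bar> \<le> 2 * \<alpha>" for s
    using \<alpha> by (auto simp: abs_mult mult_left_le)
  have As: "As = (p - 1) / (p + 1) * Bs + 4 * \<alpha> / (p + 1) * Dc"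
  proof -
    have "As = (p - 1) / (p + 1) * Bs
        - 2 / (p + 1) * integral {0..1} (\<lambda>s. s * (- 2 * \<alpha> * cos (2 * \<alpha> * s)) / power_drop p s powr (1/2))"
      unfolding As_def Bs_def
      by (rule integration_by_parts_power_drop[OF p ds _ bs]) (auto intro!: continuous_intros simp: gs_def)
    also have "(\<lambda>s. s * (- 2 * \<alpha> * cos (2 * \<alpha> * s)) / power_drop p s powr (1/2))
        = (\<lambda>s. - 2 * \<alpha> * (s * cos (2 * \<alpha> * s) / power_drop p s powr (1/2)))" by (auto simp: fun_eq_iff)
    finally show ?thesis unfolding integral_mult_right Dc_def[symmetric] by simp
  qed
  have Ac: "Ac = (p - 1) / (p + 1) * Bc - 4 * \<alpha> / (p + 1) * Ds"
  proof -
    have "Ac = (p - 1) / (p + 1) * Bc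
        - 2 / (p + 1) * integral {0..1} (\<lambda>s. s * (2 * \<alpha> * sin (2 * \<alpha> * s)) / power_drop p s powr (1/2))"
      unfolding Ac_def Bc_def
      by (rule integration_by_parts_power_drop[OF p dc _ bc]) (auto intro!: continuous_intros simp: gc_def)
    also have "(\<lambda>s. s * (2 * \<alpha> * sin (2 * \<alpha> * s)) / power_drop p s powr (1/2))
        = (\<lambda>s. 2 * \<alpha> * (s * sin (2 * \<alpha> * s) / power_drop p s powr (1/2)))" by (auto simp: fun_eq_iff)
    finally show ?thesis unfolding integral_mult_right Ds_def[symmetric] by simp
  qed
  \<comment> \<open>This turns a factor \<open>s\<close> of the integrand into the change of the exponent of the sine.\<close>
  have shift: "x powr (2 / (p + 1)) * x powr ((1 - p) / (p + 1)) = x powr ((3 - p) / (p + 1))" for x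
    using p by (simp flip: powr_add add: add_divide_distrib[symmetric])
  have C1: "C1 p = - ((p + 1) / 8) * A" unfolding C1_def A_def power_drop_def ..
  have C11: "C11 p \<alpha> = Dc"
    using sine_substitution[OF p, of "\<lambda>s. s * cos (2 * \<alpha> * s)"] p
    unfolding C11_def Dc_def shift[symmetric]
    by (simp add: mult_ac continuous_intros)
  have C21: "C21 p \<alpha> = - (1/2) * Ds"
    using sine_substitution[OF p, of "\<lambda>s. s * sin (2 * \<alpha> * s)"] p
    unfolding C21_def Ds_def shift[symmetric]
    by (simp add: mult_ac continuous_intros)
  have Ss: "integral {0..pi/2} (\<lambda>\<theta>. (sin (2 * \<alpha>) - sin (2 * \<alpha> * sin \<theta> powr (2 / (p + 1))))
      * sin \<theta> powr ((1 - p) / (p + 1))) = (p + 1) / 2 * Bs"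
    using sine_substitution[OF p, of gs] unfolding gs_def Bs_def by (simp add: continuous_intros)
  have C12: "C12 p \<alpha> = (p - 1) / 4 * Bs + (p + 1) / 4 * B"
    using p unfolding C12_def B_def power_drop_def[symmetric] Ss by (simp add: field_simps)
  have Sc: "integral {0..pi/2} (\<lambda>\<theta>. (cos (2 * \<alpha>) - cos (2 * \<alpha> * sin \<theta> powr (2 / (p + 1))))
      * sin \<theta> powr ((1 - p) / (p + 1))) = (p + 1) / 2 * Bc"
    using sine_substitution[OF p, of gc] unfolding gc_def Bc_def by (simp add: continuous_intros)
  have C22: "C22 p \<alpha> = (p - 1) / 8 * Bc"
    using p unfolding C22_def Sc by (simp add: field_simps)
  have "((\<lambda>s. 1 / 4 * ((1 - s\<^sup>2) / power_drop p s powr (3/2))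
       - 1 / (4 * \<alpha>) * (gs s / power_drop p s powr (3/2) + (1 - s) * sin (2 * \<alpha> * s) / power_drop p s powr (3/2))
       - 1 / (8 * \<alpha>\<^sup>2) * (gc s / power_drop p s powr (3/2)))
     has_integral (1 / 4 * A - 1 / (4 * \<alpha>) * (As + B) - 1 / (8 * \<alpha>\<^sup>2) * Ac)) {0..1}"
    unfolding A_def B_def As_def Ac_def
  proof (intro has_integral_diff has_integral_add has_integral_mult_right integrable_integral)
    show "(\<lambda>s. (1 - s\<^sup>2) / power_drop p s powr (3/2)) integrable_on {0..1}"
    proof (rule power_drop_quotient_integral(1)[OF p, where C = 2 and j = 1])
      show "\<bar>1 - s\<^sup>2\<bar> \<le> 2 * (1 - s) powr 1" if "s \<in> {0..<1}" for s :: real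
        using one_minus_square[of s] that by auto
    qed (auto intro!: continuous_intros)
    show "(\<lambda>s. gs s / power_drop p s powr (3/2)) integrable_on {0..1}"
      by (rule power_drop_quotient_integral(1)[OF p, where C = "2 * \<alpha>" and j = 1])
         (use lip[OF ds bs] in \<open>auto intro!: continuous_intros simp: gs_def\<close>)
    show "(\<lambda>s. gc s / power_drop p s powr (3/2)) integrable_on {0..1}"
      by (rule power_drop_quotient_integral(1)[OF p, where C = "2 * \<alpha>" and j = 1])
         (use lip[OF dc bc] in \<open>auto intro!: continuous_intros simp: gc_def\<close>)
    show "(\<lambda>s. (1 - s) * sin (2 * \<alpha> * s) / power_drop p s powr (3/2)) integrable_on {0..1}"
      by (rule power_drop_quotient_integral(1)[OF p, where C = 1 and j = 1])
         (auto intro!: continuous_intros simp: abs_mult mult_left_le)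
  qed
  also have "(\<lambda>s. 1 / 4 * ((1 - s\<^sup>2) / power_drop p s powr (3/2))
       - 1 / (4 * \<alpha>) * (gs s / power_drop p s powr (3/2) + (1 - s) * sin (2 * \<alpha> * s) / power_drop p s powr (3/2))
       - 1 / (8 * \<alpha>\<^sup>2) * (gc s / power_drop p s powr (3/2))) = (\<lambda>s. sine_drop \<alpha> s / power_drop p s powr (3/2))"
  proof
    fix s
    define q where "q = power_drop p s powr (3/2)"
    show "1 / 4 * ((1 - s\<^sup>2) / power_drop p s powr (3/2))
       - 1 / (4 * \<alpha>) * (gs s / power_drop p s powr (3/2) + (1 - s) * sin (2 * \<alpha> * s) / power_drop p s powr (3/2))
       - 1 / (8 * \<alpha>\<^sup>2) * (gc s / power_drop p s powr (3/2)) = sine_drop \<alpha> s / power_drop p s powr (3/2)"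
      unfolding sine_drop_def gs_def gc_def q_def[symmetric]
      by (cases "q = 0") (use \<alpha> in \<open>simp_all add: field_simps\<close>)
  qed
  finally have I: "integral {0..1} (\<lambda>s. sine_drop \<alpha> s / power_drop p s powr (3/2))
      = 1 / 4 * A - 1 / (4 * \<alpha>) * (As + B) - 1 / (8 * \<alpha>\<^sup>2) * Ac"
    by (rule integral_unique)
  have e: "\<alpha> powr (- p) = \<alpha> powr (1 - p) / \<alpha>" "\<alpha> powr (- (p + 1)) = \<alpha> powr (1 - p) / \<alpha>\<^sup>2"
    using \<alpha> powr_diff[of \<alpha> "1 - p" 1] powr_diff[of \<alpha> "1 - p" 2] by (simp_all add: algebra_simps)
  define \<epsilon> where "\<epsilon> = \<alpha> powr (1 - p)"
  have kAs: "(p + 1) * As = (p - 1) * Bs + 4 * \<alpha> * Dc"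
    unfolding As using p by (simp add: distrib_left)
  have kAc: "(p + 1) * Ac = (p - 1) * Bc - 4 * \<alpha> * Ds"
    unfolding Ac using p by (simp add: right_diff_distrib)
  have "- ((p + 1) / 2) * \<epsilon> * (1 / 4 * A - 1 / (4 * \<alpha>) * (As + B) - 1 / (8 * \<alpha>\<^sup>2) * Ac)
      = - ((p + 1) / 8) * A * \<epsilon> + ((p + 1) * As + (p + 1) * B) / (8 * \<alpha>) * \<epsilon>
        + (p + 1) * Ac / (16 * \<alpha>\<^sup>2) * \<epsilon>"
    using \<alpha> by (simp add: field_simps)
  also have "\<dots> = (- ((p + 1) / 8) * A + 1/2 * Dc) * \<epsilon>
      + 1/2 * ((p - 1) / 4 * Bs + (p + 1) / 4 * B + - (1/2) * Ds) * (\<epsilon> / \<alpha>)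
      + 1/2 * ((p - 1) / 8 * Bc) * (\<epsilon> / \<alpha>\<^sup>2)"
    unfolding kAs kAc using \<alpha> by (simp add: field_simps power2_eq_square)
  finally show ?thesis
    unfolding I C1 C11 C12 C21 C22 e \<epsilon>_def .
qed

section \<open>The coefficient \<open>C3\<close> is asymptotically negligible\<close>

text \<open>
  The inner integral \<open>G\<close> blows up like \<open>(1 - s) powr (-1/2)\<close>. Integrating by parts with the primitive \<open>E\<close> of
  the cosine that vanishes at \<open>s = 1\<close> moves the derivative onto \<open>G\<close>; the boundary term is then of order
  \<open>(1 - s) powr (1/2)\<close> and vanishes, and \<open>E\<close> satisfies the two bounds \<open>1 / \<alpha>\<close> and \<open>1 - s\<close>, to be interpolated.
\<close>

lemma C3_small:
  assumes p: "1 \<le> p" and \<alpha>: "1 \<le> \<alpha>"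
  shows "\<bar>C3 p \<alpha>\<bar> \<le> 3/4 * (p + 1)\<^sup>2 * \<alpha> powr (-1/4)"
proof -
  define h where "h = (\<lambda>y. (1 - y\<^sup>2) / power_drop p y powr (5/2))"
  define E where "E = (\<lambda>s. (sin (2 * \<alpha> * s) - sin (2 * \<alpha>)) / (2 * \<alpha>))"
  have dE: "(E has_real_derivative cos (2 * \<alpha> * s)) (at s)" for s
    unfolding E_def using \<alpha> by (auto intro!: derivative_eq_intros)
  have cE: "continuous_on S E" for S
    unfolding E_def using \<alpha> by (intro continuous_intros) auto
  have E1: "\<bar>E s\<bar> \<le> 1 - s" if "s \<in> {0..1}" for s
  proof -
    have "norm (E s - E 1) \<le> 1 * norm (s - 1)"
      by (rule field_differentiable_bound[of "UNIV"])
         (use dE in \<open>auto intro: has_field_derivative_at_within\<close>)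
    then show ?thesis using that by (auto simp: E_def)
  qed
  have E2: "\<bar>E s\<bar> \<le> 1 / \<alpha>" for s
  proof -
    have "\<bar>sin (2 * \<alpha> * s) - sin (2 * \<alpha>)\<bar> \<le> 2"
      using sin_le_one[of "2*\<alpha>"] sin_ge_minus_one[of "2*\<alpha>"]
        sin_le_one[of "2 * \<alpha> * s"] sin_ge_minus_one[of "2 * \<alpha> * s"] by linarith
    then show ?thesis using \<alpha> by (simp add: E_def abs_divide field_simps)
  qed
  have E: "\<bar>E s\<bar> \<le> \<alpha> powr (-1/4) * (1 - s) powr (3/4)" if "s \<in> {0..1}" for s
    using min_le_weighted[OF _ E2 E1[OF that], of "3/4"] \<alpha>
    by (simp add: powr_divide powr_minus_divide)
  have b: "\<bar>(1 - s\<^sup>2) * E s\<bar> \<le> 2 * \<alpha> powr (-1/4) * (1 - s) powr (7/4)" if s: "s \<in> {0..<1}" for s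
  proof -
    have "\<bar>(1 - s\<^sup>2) * E s\<bar> \<le> (2 * (1 - s)) * (\<alpha> powr (-1/4) * (1 - s) powr (3/4))"
      unfolding abs_mult using one_minus_square[of s] E[of s] s by (intro mult_mono) auto
    also have "\<dots> = 2 * \<alpha> powr (-1/4) * ((1 - s) powr 1 * (1 - s) powr (3/4))" using s by simp
    also have "(1 - s) powr 1 * (1 - s) powr (3/4) = (1 - s) powr (7/4)"
      by (subst powr_add[symmetric]) simp
    finally show ?thesis .
  qed
  have c: "continuous_on {0..<1} (\<lambda>s. (1 - s\<^sup>2) * E s)" by (intro continuous_intros cE)
  note I = power_drop_quotient_integral[OF p c b, of "5/2"]
  have Qn: "power_drop p s \<noteq> 0" if "s \<in> {0..<1}" for s using power_drop_pos[OF p, of s] that by auto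
  have ch: "continuous_on {0..<1} h"
    unfolding h_def by (intro continuous_intros continuous_on_power_drop p) (use Qn in auto)
  have hb: "0 \<le> h y" "h y \<le> 2 * (1 - y) powr (-3/2)" if y: "y \<in> {0..<1}" for y
  proof -
    show "0 \<le> h y" unfolding h_def using one_minus_square(1)[of y] y by simp
    have "h y \<le> 2 * (1 - y) / (1 - y) powr (5/2)" unfolding h_def
      by (intro frac_le) (use y one_minus_square[of y] power_drop_lower[OF p, of y] in \<open>auto intro!: powr_mono2\<close>)
    also have "\<dots> = 2 * ((1 - y) powr 1 / (1 - y) powr (5/2))" using y by simp
    also have "\<dots> = 2 * (1 - y) powr (-3/2)" by (subst powr_diff[symmetric]) simp
    finally show "h y \<le> 2 * (1 - y) powr (-3/2)" .
  qed
  have hi: "h integrable_on {0..s}" if "s < 1" for s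
    using that by (intro integrable_continuous_real continuous_on_subset[OF ch]) auto
  define G where "G = (\<lambda>s. integral {0..s} h)"
  have G: "0 \<le> G s" "G s \<le> 4 * (1 - s) powr (-1/2)" if s: "s \<in> {0..<1}" for s
  proof -
    show "0 \<le> G s" unfolding G_def using hb(1) s hi by (intro integral_nonneg) auto
    have W: "((\<lambda>y. 2 * (1 - y) powr (-3/2)) has_integral
        (4 * (1 - s) powr (-1/2) - 4 * (1 - 0) powr (-1/2))) {0..s}"
    proof (rule fundamental_theorem_of_calculus)
      show "((\<lambda>y. 4 * (1 - y) powr (-1/2)) has_vector_derivative 2 * (1 - x) powr (-3/2))
          (at x within {0..s})" if "x \<in> {0..s}" for x
        unfolding has_real_derivative_iff_has_vector_derivative[symmetric]
        using that s by (auto intro!: derivative_eq_intros)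
    qed (use s in auto)
    have "G s \<le> 4 * (1 - s) powr (-1/2) - 4 * (1 - 0) powr (-1/2)"
      unfolding G_def by (rule has_integral_le[OF integrable_integral[OF hi] W]) (use s hb in auto)
    then show "G s \<le> 4 * (1 - s) powr (-1/2)" by simp
  qed
  have dG: "(G has_real_derivative h x) (at x)" if x: "x \<in> {0<..<1}" for x
  proof -
    define b where "b = (1 + x) / 2"
    have xb: "0 < x" "x < b" "b < 1" using x by (auto simp: b_def)
    have "(G has_real_derivative h x) (at x within {0..b})" unfolding G_def
      by (rule integral_has_real_derivative[OF continuous_on_subset[OF ch]]) (use xb in auto)
    then show ?thesis using at_within_Icc_at[of 0 x b] xb by simp
  qed
  have "((\<lambda>s. h s * E s + cos (2 * \<alpha> * s) * G s) has_integral (G 1 * E 1 - G 0 * E 0)) {0..1}"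
  proof (rule fundamental_theorem_of_calculus_interior)
    show "continuous_on {0..1} (\<lambda>s. G s * E s)"
      unfolding continuous_on_eq_continuous_within
    proof
      fix x :: real assume x: "x \<in> {0..1}"
      show "continuous (at x within {0..1}) (\<lambda>s. G s * E s)"
      proof (cases "x = 1")
        case False
        define b where "b = (1 + x) / 2"
        have xb: "0 \<le> x" "x < b" "b < 1" using x False by (auto simp: b_def)
        have "continuous_on {0..b} G" unfolding G_def
          by (rule indefinite_integral_continuous_1[OF hi[OF xb(3)]])
        then have "continuous (at x within {0..b}) G"
          using xb by (simp add: continuous_on_eq_continuous_within)
        moreover have "at x within {0..b} = at x within {0..1}"
          by (rule at_within_nhd[of _ "{..<b}"]) (use xb in auto)
        ultimately show ?thesis using cE[of "{0..1}"] x
          by (auto intro!: continuous_mult simp: continuous_on_eq_continuous_within)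
      next
        case True
        have "norm (G s * E s) \<le> 4 * (1 - s) powr (1/2)" if s: "s \<in> {0..1}" "s \<noteq> 1" for s
        proof -
          have "norm (G s * E s) \<le> 4 * (1 - s) powr (-1/2) * (1 - s)"
            unfolding real_norm_def abs_mult using s G[of s] E1[OF s(1)] by (intro mult_mono) auto
          also have "\<dots> = 4 * ((1 - s) powr (-1/2) * (1 - s) powr 1)" using s by simp
          also have "\<dots> = 4 * (1 - s) powr (1/2)" by (subst powr_add[symmetric]) simp
          finally show ?thesis .
        qed
        then have "\<forall>\<^sub>F s in at 1 within {0..1}. norm (G s * E s) \<le> 4 * (1 - s) powr (1/2)"
          unfolding eventually_at_filter by (intro always_eventually) blast
        from Lim_null_comparison[OF this sqrt_weight_tendsto]
        have "((\<lambda>s. G s * E s) \<longlongrightarrow> 0) (at 1 within {0..1})" .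
        then show ?thesis using True by (simp add: continuous_within E_def)
      qed
    qed
    show "((\<lambda>s. G s * E s) has_vector_derivative h x * E x + cos (2 * \<alpha> * x) * G x) (at x)"
      if "x \<in> {0<..<1}" for x
      unfolding has_real_derivative_iff_has_vector_derivative[symmetric]
      by (rule DERIV_mult[OF dG[OF that] dE])
  qed simp
  then have "((\<lambda>s. h s * E s + cos (2 * \<alpha> * s) * G s) has_integral 0) {0..1}"
    by (simp add: E_def G_def)
  \<comment> \<open>The product is integrable although \<open>h\<close> is not; subtracting it isolates the integrand of \<open>C3\<close>.\<close>
  moreover have hE: "h s * E s = (1 - s\<^sup>2) * E s / power_drop p s powr (5/2)" for s
    by (simp add: h_def)
  have "((\<lambda>s. h s * E s) has_integral integral {0..1} (\<lambda>s. (1 - s\<^sup>2) * E s / power_drop p s powr (5/2))) {0..1}"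
    unfolding hE by (rule integrable_integral[OF I(1)]) auto
  ultimately have "((\<lambda>s. h s * E s + cos (2 * \<alpha> * s) * G s - h s * E s) has_integral
      (0 - integral {0..1} (\<lambda>s. (1 - s\<^sup>2) * E s / power_drop p s powr (5/2)))) {0..1}"
    by (rule has_integral_diff)
  then have "((\<lambda>s. G s * cos (2 * \<alpha> * s)) has_integral
      - integral {0..1} (\<lambda>s. (1 - s\<^sup>2) * E s / power_drop p s powr (5/2))) {0..1}"
    by (simp add: mult.commute)
  from integral_unique[OF this] have "C3 p \<alpha> = 3/32 * (p + 1)\<^sup>2 *
      integral {0..1} (\<lambda>s. (1 - s\<^sup>2) * E s / power_drop p s powr (5/2))"
    unfolding C3_def G_def h_def power_drop_def by simp
  then have "\<bar>C3 p \<alpha>\<bar> = 3/32 * (p + 1)\<^sup>2 *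
      \<bar>integral {0..1} (\<lambda>s. (1 - s\<^sup>2) * E s / power_drop p s powr (5/2))\<bar>"
    by (simp only: abs_mult) simp
  also have "\<dots> \<le> 3/32 * (p + 1)\<^sup>2 * (4 * (2 * \<alpha> powr (-1/4)))"
    by (intro mult_left_mono I(2)) auto
  finally show ?thesis by simp
qed

section \<open>The time map\<close>

lemma inverse_sqrt_perturbed:
  assumes p: "1 \<le> p" and \<alpha>: "0 < \<alpha>" and \<delta>: "0 \<le> \<delta>"
  shows "\<And>s. 0 \<le> s \<Longrightarrow> s < 1 \<Longrightarrow> 0 < power_drop p s + \<delta> * sine_drop \<alpha> s"
    and "continuous_on {0..<1} (\<lambda>s. 1 / sqrt (power_drop p s + \<delta> * sine_drop \<alpha> s))"
    and "(\<lambda>s. 1 / sqrt (power_drop p s + \<delta> * sine_drop \<alpha> s)) integrable_on {0..1}"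
proof -
  have le: "1 - s \<le> power_drop p s + \<delta> * sine_drop \<alpha> s" if "0 \<le> s" "s < 1" for s
    using power_drop_lower[OF p, of s] mult_nonneg_nonneg[OF \<delta> sine_drop_nonneg[OF \<alpha>, of s]] that by linarith
  then show pos: "0 < power_drop p s + \<delta> * sine_drop \<alpha> s" if "0 \<le> s" "s < 1" for s
    using that by force
  have ne: "sqrt (power_drop p s + \<delta> * sine_drop \<alpha> s) \<noteq> 0" if "s \<in> {0..<1}" for s
    using pos[of s] that by simp
  show c: "continuous_on {0..<1} (\<lambda>s. 1 / sqrt (power_drop p s + \<delta> * sine_drop \<alpha> s))"
    by (intro continuous_intros continuous_on_power_drop p continuous_on_sine_drop \<alpha>) (use ne in auto)
  show "(\<lambda>s. 1 / sqrt (power_drop p s + \<delta> * sine_drop \<alpha> s)) integrable_on {0..1}"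
  proof (rule weight_integrable(1)[OF c, where C = 1])
    fix s :: real assume s: "s \<in> {0..<1}"
    have "1 / sqrt (power_drop p s + \<delta> * sine_drop \<alpha> s) \<le> 1 / sqrt (1 - s)"
      using s le[of s] by (intro divide_left_mono real_sqrt_le_mono mult_pos_pos) (auto simp: pos)
    also have "\<dots> = (1 - s) powr (-1/2)" using s by (simp add: powr_minus_divide powr_half_sqrt)
    also have "\<dots> \<le> (1 - s) powr (-3/4)" using s by (intro powr_mono') auto
    finally show "\<bar>1 / sqrt (power_drop p s + \<delta> * sine_drop \<alpha> s)\<bar> \<le> 1 * (1 - s) powr (-3/4)"
      using pos[of s] s by simp
  qed
qed

text \<open>
  Let \<open>x0\<close> be a point where \<open>v\<close> is maximal and let \<open>w = v / \<alpha>\<close>. Conservation of energy reads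
  \<open>w'\<^sup>2 = c * P(w)\<close>, with \<open>P\<close> the normalized potential drop and \<open>P 1 = 0\<close>. Since \<open>v''\<close> is negative, \<open>v'\<close> is
  positive before \<open>x0\<close> and negative after it, so \<open>w' / sqrt (P(w))\<close> equals \<open>sqrt c\<close> on the left and \<open>- sqrt c\<close> on
  the right. Integration shows that both \<open>sqrt c * x0\<close> and \<open>sqrt c * (1 - x0)\<close> equal the integral \<open>J\<close> of
  \<open>1 / sqrt P\<close>, hence \<open>sqrt c = 2 * J\<close>.
\<close>

lemma time_map:
  assumes p: "1 \<le> p" and m: "0 < m" and \<alpha>: "0 < \<alpha>"
    and sol: "is_solution p m v" and sup: "sup_norm v = \<alpha>"
  shows "m = 2 * (p + 1) * \<alpha> powr (1 - p) *
    (integral {0..1} (\<lambda>s. 1 / sqrt (power_drop p s + (p + 1) * \<alpha> powr (1 - p) * sine_drop \<alpha> s)))\<^sup>2"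
proof -
  define \<delta> where "\<delta> = (p + 1) * \<alpha> powr (1 - p)"
  define P where "P = (\<lambda>s. power_drop p s + \<delta> * sine_drop \<alpha> s)"
  define g where "g = (\<lambda>s. 1 / sqrt (P s))"
  define c where "c = 2 * m * \<alpha> powr (p - 1) / (p + 1)"
  have \<delta>: "0 \<le> \<delta>" using p by (simp add: \<delta>_def)
  have c: "0 < c" using p m \<alpha> by (simp add: c_def)
  have P_pos: "0 < P s" if "0 \<le> s" "s < 1" for s
    using inverse_sqrt_perturbed(1)[OF p \<alpha> \<delta> that] by (simp add: P_def)
  have gI: "g integrable_on {0..1}" and gc: "continuous_on {0<..<1} g"
    using inverse_sqrt_perturbed(2,3)[OF p \<alpha> \<delta>]
    by (auto simp: g_def P_def elim: continuous_on_subset)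
  have P1: "P 1 = 0" by (simp add: P_def)
  have dP: "(P has_real_derivative
      - (p + 1) * s powr p + \<delta> * (- s * (sin (\<alpha> * s))\<^sup>2)) (at s)" if "0 < s" for s
    unfolding P_def by (intro DERIV_add DERIV_cmult power_drop_deriv sine_drop_deriv that \<alpha>)
  obtain v' v'' where
    d1: "\<And>x. x \<in> {0..1} \<Longrightarrow> (v has_real_derivative v' x) (at x within {0..1})" and
    d2: "\<And>x. x \<in> {0..1} \<Longrightarrow> (v' has_real_derivative v'' x) (at x within {0..1})" and
    ode: "\<And>x. x \<in> {0<..<1} \<Longrightarrow> - v'' x = m * (v x powr p + v x * (sin (v x))\<^sup>2)"
    using sol unfolding is_solution_def C2_with_derivs_def by blast
  have pos: "\<And>x. x \<in> {0<..<1} \<Longrightarrow> 0 < v x" and v0: "v 0 = 0" and v1: "v 1 = 0"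
    using sol unfolding is_solution_def by auto
  have nonneg: "0 \<le> v x" if "x \<in> {0..1}" for x
    using pos[of x] v0 v1 that by (cases "x = 0 \<or> x = 1") auto
  have D1: "(v has_real_derivative v' x) (at x)" and D2: "(v' has_real_derivative v'' x) (at x)"
    if "x \<in> {0<..<1}" for x
    using d1[of x] d2[of x] at_within_Icc_at[of 0 x 1] that by auto
  have vc: "continuous_on {0..1} v" using d1 by (rule DERIV_continuous_on)
  obtain x0 where x0: "x0 \<in> {0..1}" "\<And>x. x \<in> {0..1} \<Longrightarrow> v x \<le> v x0"
    using continuous_attains_sup[OF compact_Icc _ vc] by auto
  have "sup_norm v = v x0"
    unfolding sup_norm_def by (rule cSup_eq_maximum) (use x0 nonneg in \<open>auto intro!: image_eqI[of _ _ x0]\<close>)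
  then have vx0: "v x0 = \<alpha>" using sup by simp
  then have x0': "x0 \<in> {0<..<1}" using x0(1) \<alpha> v0 v1 by (cases "x0 = 0 \<or> x0 = 1") auto
  have v'0: "v' x0 = 0"
  proof (rule DERIV_local_max[OF D1[OF x0'], of "min x0 (1 - x0)"])
    show "\<forall>y. \<bar>x0 - y\<bar> < min x0 (1 - x0) \<longrightarrow> v y \<le> v x0"
      by (intro allI impI x0(2)) auto
  qed (use x0' in auto)
  \<comment> \<open>The energy, up to a constant factor and an additive constant chosen so that it vanishes at \<open>x0\<close>.\<close>
  have "((\<lambda>x. (v' x)\<^sup>2 - c * \<alpha>\<^sup>2 * P (v x / \<alpha>)) has_real_derivative 0) (at x)"
    if x: "x \<in> {0<..<1}" for x
  proof -
    have "((\<lambda>x. (v' x)\<^sup>2) has_real_derivative 2 * v' x * v'' x) (at x)"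
      by (auto intro!: derivative_eq_intros D2[OF x])
    moreover have "((\<lambda>x. P (v x / \<alpha>)) has_real_derivative
        (- (p + 1) * (v x / \<alpha>) powr p + \<delta> * (- (v x / \<alpha>) * (sin (\<alpha> * (v x / \<alpha>)))\<^sup>2)) * (v' x / \<alpha>)) (at x)"
      by (rule DERIV_chain2[OF dP DERIV_cdivide[OF D1[OF x]]]) (use pos[OF x] \<alpha> in simp)
    ultimately have *: "((\<lambda>x. (v' x)\<^sup>2 - c * \<alpha>\<^sup>2 * P (v x / \<alpha>)) has_real_derivative
        2 * v' x * v'' x - c * \<alpha>\<^sup>2 * ((- (p + 1) * (v x / \<alpha>) powr p
          + \<delta> * (- (v x / \<alpha>) * (sin (\<alpha> * (v x / \<alpha>)))\<^sup>2)) * (v' x / \<alpha>))) (at x)"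
      by (intro DERIV_diff DERIV_cmult)
    have e1: "c * \<alpha> * (p + 1) * (v x / \<alpha>) powr p = 2 * m * v x powr p"
    proof -
      have "\<alpha> powr (p - 1) * \<alpha> = \<alpha> powr p" using \<alpha> powr_add[of \<alpha> "p - 1" 1] by simp
      moreover have "(v x / \<alpha>) powr p = v x powr p / \<alpha> powr p"
        using \<alpha> pos[OF x] by (simp add: powr_divide)
      moreover have "c * \<alpha> * (p + 1) = 2 * m * (\<alpha> powr (p - 1) * \<alpha>)"
        using p by (simp add: c_def field_simps)
      ultimately show ?thesis using \<alpha> by simp
    qed
    have e2: "c * \<delta> = 2 * m"
    proof -
      have "\<alpha> powr (p - 1) * \<alpha> powr (1 - p) = 1" using \<alpha> by (simp flip: powr_add)
      moreover have "c * \<delta> = 2 * m * (\<alpha> powr (p - 1) * \<alpha> powr (1 - p))"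
        using p by (simp add: c_def \<delta>_def field_simps)
      ultimately show ?thesis by simp
    qed
    have "c * \<alpha>\<^sup>2 * ((- (p + 1) * (v x / \<alpha>) powr p
          + \<delta> * (- (v x / \<alpha>) * (sin (\<alpha> * (v x / \<alpha>)))\<^sup>2)) * (v' x / \<alpha>))
        = - v' x * (c * \<alpha> * (p + 1) * (v x / \<alpha>) powr p + (c * \<delta>) * v x * (sin (v x))\<^sup>2)"
      using \<alpha> by (simp add: field_simps power2_eq_square)
    also have "\<dots> = 2 * v' x * v'' x"
    proof -
      have v'': "v'' x = - (m * (v x powr p + v x * (sin (v x))\<^sup>2))" using ode[OF x] by simp
      show ?thesis unfolding v'' e1 e2 by (simp add: algebra_simps)
    qed
    finally show ?thesis using * by simp
  qed
  then have "\<exists>k. \<forall>x\<in>{0<..<1}. (v' x)\<^sup>2 - c * \<alpha>\<^sup>2 * P (v x / \<alpha>) = k"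
    by (intro has_field_derivative_zero_constant[where f = "\<lambda>x. (v' x)\<^sup>2 - c * \<alpha>\<^sup>2 * P (v x / \<alpha>)"])
       (auto intro: has_field_derivative_at_within)
  then obtain k where k: "(v' x)\<^sup>2 - c * \<alpha>\<^sup>2 * P (v x / \<alpha>) = k" if "x \<in> {0<..<1}" for x
    by blast
  have "k = 0" using k[OF x0'] v'0 vx0 P1 \<alpha> by simp
  then have energy: "(v' x / \<alpha>)\<^sup>2 = c * P (v x / \<alpha>)" if "x \<in> {0<..<1}" for x
    using k[OF that] \<alpha> by (simp add: power_divide field_simps)
  have dec: "v' y < v' x" if "0 < x" "x < y" "y < 1" for x y
  proof (rule DERIV_neg_imp_decreasing[OF that(2)])
    fix t assume t: "x \<le> t" "t \<le> y"
    then have t': "t \<in> {0<..<1}" using that by auto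
    have "0 < v t powr p + v t * (sin (v t))\<^sup>2"
      using pos[OF t'] by (intro add_pos_nonneg) auto
    then have "v'' t < 0" using ode[OF t'] m by (simp add: zero_less_mult_iff flip: neg_0_less_iff_less)
    then show "\<exists>l. (v' has_real_derivative l) (at t) \<and> l < 0" using D2[OF t'] by blast
  qed
  have half: "integral {0..v b / \<alpha>} g - integral {0..v a / \<alpha>} g = \<sigma> * sqrt c * (b - a)"
    if ab: "0 \<le> a" "a < b" "b \<le> 1" and \<sigma>: "\<And>x. x \<in> {a<..<b} \<Longrightarrow> sgn (v' x) = \<sigma>" "\<sigma> \<noteq> 0" for a b \<sigma>
  proof -
    have w: "0 < v x / \<alpha> \<and> v x / \<alpha> < 1" if x: "x \<in> {a<..<b}" for x
    proof -
      have x': "x \<in> {0<..<1}" using x ab by auto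
      have "v' x \<noteq> 0" using \<sigma> x by force
      then have "P (v x / \<alpha>) \<noteq> 0" using energy[OF x'] \<alpha> by auto
      then have "v x \<noteq> \<alpha>" using P1 \<alpha> by auto
      moreover have "v x \<le> \<alpha>" using x0(2)[of x] vx0 x' by simp
      ultimately show ?thesis using pos[OF x'] \<alpha> by simp
    qed
    have "((\<lambda>x. g (v x / \<alpha>) * (v' x / \<alpha>)) has_integral
        (integral {0..v b / \<alpha>} g - integral {0..v a / \<alpha>} g)) {a..b}"
    proof (rule integral_substitution_interior[OF _ _ _ w _ gI gc])
      show "continuous_on {a..b} (\<lambda>x. v x / \<alpha>)"
        by (intro continuous_intros continuous_on_subset[OF vc]) (use ab \<alpha> in auto)
      show "(\<lambda>x. v x / \<alpha>) ` {a..b} \<subseteq> {0..1}"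
        using ab nonneg x0(2) vx0 \<alpha> by auto
      show "((\<lambda>x. v x / \<alpha>) has_real_derivative v' x / \<alpha>) (at x)" if "x \<in> {a<..<b}" for x
        using that ab by (intro DERIV_cdivide D1) auto
    qed (use ab in auto)
    moreover have "g (v x / \<alpha>) * (v' x / \<alpha>) = \<sigma> * sqrt c" if x: "x \<in> box a b" for x
    proof -
      have x': "x \<in> {0<..<1}" using x ab by auto
      have Pw: "0 < P (v x / \<alpha>)" using w[of x] x by (intro P_pos) auto
      have "\<bar>v' x / \<alpha>\<bar> = sqrt c * sqrt (P (v x / \<alpha>))"
        using energy[OF x'] by (simp flip: real_sqrt_abs real_sqrt_mult)
      moreover have "v' x / \<alpha> = \<sigma> * \<bar>v' x / \<alpha>\<bar>"
        using \<sigma>(1)[of x] x \<alpha> sgn_mult_abs[of "v' x"] by simp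
      ultimately have "v' x / \<alpha> = \<sigma> * (sqrt c * sqrt (P (v x / \<alpha>)))" by simp
      then show ?thesis using Pw by (simp add: g_def)
    qed
    ultimately have "((\<lambda>x. \<sigma> * sqrt c) has_integral
        (integral {0..v b / \<alpha>} g - integral {0..v a / \<alpha>} g)) {a..b}"
      using has_integral_spike_interior_eq[of a b "\<lambda>x. \<sigma> * sqrt c" "\<lambda>x. g (v x / \<alpha>) * (v' x / \<alpha>)"]
      by simp
    from integral_unique[OF this] show ?thesis using ab by (simp add: mult_ac)
  qed
  define J where "J = integral {0..1} g"
  have "integral {0..v x0 / \<alpha>} g - integral {0..v 0 / \<alpha>} g = 1 * sqrt c * (x0 - 0)"
  proof (rule half)
    show "sgn (v' x) = 1" if "x \<in> {0<..<x0}" for x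
      using dec[of x x0] that x0' v'0 by simp
  qed (use x0' in auto)
  then have "J = sqrt c * x0" using v0 vx0 \<alpha> by (simp add: J_def)
  moreover have "integral {0..v 1 / \<alpha>} g - integral {0..v x0 / \<alpha>} g = - 1 * sqrt c * (1 - x0)"
  proof (rule half)
    show "sgn (v' x) = - 1" if "x \<in> {x0<..<1}" for x
      using dec[of x0 x] that x0' v'0 by simp
  qed (use x0' in auto)
  then have "J = sqrt c - sqrt c * x0" using v1 vx0 \<alpha> by (simp add: J_def right_diff_distrib)
  ultimately have "2 * J = sqrt c" by linarith
  then have "(2 * J)\<^sup>2 = c" using c by simp
  then have J: "J\<^sup>2 = c / 4" by (simp add: power_mult_distrib)
  have "\<alpha> powr (p - 1) * \<alpha> powr (1 - p) = 1" using \<alpha> by (simp flip: powr_add)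
  then have "m = 2 * (p + 1) * \<alpha> powr (1 - p) * (c / 4)"
    using p by (simp add: c_def field_simps)
  then show ?thesis unfolding J[symmetric] unfolding J_def g_def P_def \<delta>_def .
qed

section \<open>Expansion of the time integral\<close>

text \<open>
  In terms of \<open>t = sqrt (1 + x)\<close> the remainder becomes a polynomial divided by \<open>t\<close>, and that polynomial has the
  triple root \<open>t = 1\<close>; comparing its cofactor with that of \<open>x ^ 3 = (t - 1) ^ 3 * (t + 1) ^ 3\<close> gives the
  estimate for all \<open>x \<ge> 0\<close> at once.
\<close>

lemma inverse_sqrt_taylor:
  fixes x :: real
  assumes "0 \<le> x"
  shows "\<bar>1 / sqrt (1 + x) - (1 - x / 2 + 3 / 8 * x\<^sup>2)\<bar> \<le> x ^ 3"
proof -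
  define t where "t = sqrt (1 + x)"
  have t: "1 \<le> t" using assms by (simp add: t_def)
  have x: "x = t\<^sup>2 - 1" using assms by (simp add: t_def)
  have *: "t * (1 - x / 2 + 3 / 8 * x\<^sup>2) - 1 = (t - 1) ^ 3 * ((3 * t\<^sup>2 + 9 * t + 8) / 8)"
    unfolding x by (simp add: field_simps power2_eq_square power3_eq_cube)
  have "(3 * t\<^sup>2 + 9 * t + 8) / 8 \<le> (t + 1) ^ 3 * t"
  proof -
    have "(3 * u + 9 * t + 8) / 8 \<le> 4 * u" if "t \<le> u" "1 \<le> u" for u :: real
    proof -
      have "3 * u + 9 * t + 8 \<le> 4 * u * 8" using that by linarith
      then show ?thesis by simp
    qed
    from this[of "t\<^sup>2"] have "(3 * t\<^sup>2 + 9 * t + 8) / 8 \<le> 4 * t\<^sup>2"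
      using t by (simp add: self_le_power)
    also have "\<dots> = 4 * t * t" by (simp add: power2_eq_square)
    also have "\<dots> \<le> (t + 1) ^ 3 * t"
    proof (rule mult_right_mono)
      have "2\<^sup>2 * (t + 1) \<le> (t + 1)\<^sup>2 * (t + 1)"
        using t by (intro mult_right_mono power_mono) auto
      then show "4 * t \<le> (t + 1) ^ 3" using t by (simp add: power3_eq_cube power2_eq_square)
    qed (use t in simp)
    finally show ?thesis .
  qed
  then have "(t - 1) ^ 3 * ((3 * t\<^sup>2 + 9 * t + 8) / 8) \<le> (t - 1) ^ 3 * ((t + 1) ^ 3 * t)"
    using t by (intro mult_left_mono) auto
  also have "\<dots> = t * x ^ 3" unfolding x by (simp add: field_simps power2_eq_square power3_eq_cube)
  finally have u: "t * (1 - x / 2 + 3 / 8 * x\<^sup>2) - 1 \<le> t * x ^ 3" using * by simp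
  have l: "0 \<le> t * (1 - x / 2 + 3 / 8 * x\<^sup>2) - 1" unfolding * using t by simp
  have "1 / t - (1 - x / 2 + 3 / 8 * x\<^sup>2) = - (t * (1 - x / 2 + 3 / 8 * x\<^sup>2) - 1) / t"
    using t by (simp add: field_simps)
  then have "\<bar>1 / t - (1 - x / 2 + 3 / 8 * x\<^sup>2)\<bar> = (t * (1 - x / 2 + 3 / 8 * x\<^sup>2) - 1) / t"
    using l t by (simp only: abs_divide abs_minus_cancel)
  also have "\<dots> \<le> t * x ^ 3 / t" using u t by (intro divide_right_mono) auto
  also have "\<dots> = x ^ 3" using t by simp
  finally show ?thesis unfolding t_def .
qed

lemma sine_drop_le:
  assumes "0 < \<alpha>" "0 \<le> s" "s \<le> 1"
  shows "sine_drop \<alpha> s \<le> 1 - s"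
  using sine_drop_upper[OF assms] one_minus_square[OF assms(2,3)] by simp

text \<open>
  Taylor's formula with \<open>x = \<delta> * sine_drop / power_drop\<close>, which lies between \<open>0\<close> and \<open>\<delta>\<close>. The remainder is
  therefore at most \<open>\<delta> ^ 3\<close> times the integrable function \<open>1 / sqrt power_drop\<close>.
\<close>

lemma time_integral_expansion:
  assumes p: "1 \<le> p" and \<alpha>: "0 < \<alpha>" and \<delta>: "0 \<le> \<delta>"
  shows "\<bar>integral {0..1} (\<lambda>s. 1 / sqrt (power_drop p s + \<delta> * sine_drop \<alpha> s))
     - (C0 p - \<delta> / 2 * integral {0..1} (\<lambda>s. sine_drop \<alpha> s / power_drop p s powr (3/2))
        + 3 / 8 * \<delta>\<^sup>2 * integral {0..1} (\<lambda>s. (sine_drop \<alpha> s)\<^sup>2 / power_drop p s powr (5/2)))\<bar> \<le> 4 * \<delta> ^ 3"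
proof -
  define R where "R = (\<lambda>s. 1 / sqrt (power_drop p s + \<delta> * sine_drop \<alpha> s)
     - (1 / sqrt (power_drop p s) - \<delta> / 2 * (sine_drop \<alpha> s / power_drop p s powr (3/2))
        + 3 / 8 * \<delta>\<^sup>2 * ((sine_drop \<alpha> s)\<^sup>2 / power_drop p s powr (5/2))))"
  have H: "0 \<le> sine_drop \<alpha> s" "sine_drop \<alpha> s \<le> 1 - s" if "s \<in> {0..1}" for s
    using sine_drop_nonneg[OF \<alpha>, of s] sine_drop_le[OF \<alpha>, of s] that by auto
  have Hc: "continuous_on S (sine_drop \<alpha>)" for S by (rule continuous_on_sine_drop[OF \<alpha>])
  have "((\<lambda>s. 1 / sqrt (power_drop p s)) has_integral C0 p) {0..1}"
    using integrable_integral[OF inverse_sqrt_perturbed(3)[OF p \<alpha>, of 0]] by (simp add: C0_def power_drop_def)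
  moreover have "(\<lambda>s. sine_drop \<alpha> s / power_drop p s powr (3/2)) integrable_on {0..1}"
    by (rule power_drop_quotient_integral(1)[OF p Hc, where C = 1 and j = 1]) (use H in auto)
  moreover have "(\<lambda>s. (sine_drop \<alpha> s)\<^sup>2 / power_drop p s powr (5/2)) integrable_on {0..1}"
    by (rule power_drop_quotient_integral(1)[OF p _, where C = 1 and j = 2])
       (use H in \<open>auto intro!: continuous_intros Hc power_mono\<close>)
  ultimately have "(R has_integral (integral {0..1} (\<lambda>s. 1 / sqrt (power_drop p s + \<delta> * sine_drop \<alpha> s))
     - (C0 p - \<delta> / 2 * integral {0..1} (\<lambda>s. sine_drop \<alpha> s / power_drop p s powr (3/2))
        + 3 / 8 * \<delta>\<^sup>2 * integral {0..1} (\<lambda>s. (sine_drop \<alpha> s)\<^sup>2 / power_drop p s powr (5/2))))) {0..1}"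
    unfolding R_def
    by (intro has_integral_diff has_integral_add has_integral_mult_right integrable_integral
        inverse_sqrt_perturbed(3)[OF p \<alpha> \<delta>])
  moreover have "\<bar>integral {0..1} R\<bar> \<le> 4 * \<delta> ^ 3"
  proof (rule weight_integrable(2))
    have "power_drop p s \<noteq> 0" if "s \<in> {0..<1}" for s using power_drop_pos[OF p, of s] that by auto
    then show "continuous_on {0..<1} R" unfolding R_def
      by (intro continuous_intros inverse_sqrt_perturbed(2)[OF p \<alpha> \<delta>] Hc continuous_on_power_drop p) auto
    fix s :: real assume s: "s \<in> {0..<1}"
    define q where "q = sqrt (power_drop p s)"
    define x where "x = \<delta> * sine_drop \<alpha> s / q\<^sup>2"
    have Q: "0 < power_drop p s" using power_drop_pos[OF p, of s] s by simp
    then have q: "0 < q" "power_drop p s = q\<^sup>2" by (simp_all add: q_def)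
    have pw: "power_drop p s powr (3/2) = q ^ 3" "power_drop p s powr (5/2) = q ^ 5"
      using Q unfolding q_def by (simp_all add: powr_power powr_powr flip: powr_half_sqrt)
    have x0: "0 \<le> x" using H[of s] s \<delta> by (simp add: x_def)
    have "sine_drop \<alpha> s \<le> q\<^sup>2" using H(2)[of s] power_drop_lower[OF p, of s] s unfolding q(2) by simp
    then have x1: "x \<le> \<delta>" using q \<delta> by (simp add: x_def field_simps mult_left_mono)
    have "R s = (1 / sqrt (1 + x) - (1 - x / 2 + 3 / 8 * x\<^sup>2)) / q"
    proof -
      have Hx: "\<delta> * sine_drop \<alpha> s = q\<^sup>2 * x" using q by (simp add: x_def)
      have "power_drop p s + \<delta> * sine_drop \<alpha> s = q\<^sup>2 * (1 + x)" unfolding Hx q(2) by (simp add: algebra_simps)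
      then have "sqrt (power_drop p s + \<delta> * sine_drop \<alpha> s) = q * sqrt (1 + x)"
        using q by (simp add: real_sqrt_mult)
      moreover have "\<delta> / 2 * (sine_drop \<alpha> s / q ^ 3) = x / 2 / q"
        using q by (simp add: x_def power2_eq_square power3_eq_cube)
      moreover have "3 / 8 * \<delta>\<^sup>2 * ((sine_drop \<alpha> s)\<^sup>2 / q ^ 5) = 3 / 8 * x\<^sup>2 / q"
        using q by (simp add: x_def field_simps power2_eq_square eval_nat_numeral)
      ultimately show ?thesis unfolding R_def pw q_def[symmetric]
        by (simp add: diff_divide_distrib add_divide_distrib)
    qed
    then have "\<bar>R s\<bar> = \<bar>1 / sqrt (1 + x) - (1 - x / 2 + 3 / 8 * x\<^sup>2)\<bar> / q"
      using q by (simp only: abs_divide)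
    also have "\<dots> \<le> \<delta> ^ 3 / sqrt (1 - s)"
    proof (rule frac_le)
      show "\<bar>1 / sqrt (1 + x) - (1 - x / 2 + 3 / 8 * x\<^sup>2)\<bar> \<le> \<delta> ^ 3"
        using inverse_sqrt_taylor[OF x0] power_mono[OF x1 x0, of 3] by linarith
      show "sqrt (1 - s) \<le> q" unfolding q_def using power_drop_lower[OF p, of s] s by simp
    qed (use s \<delta> in auto)
    also have "\<dots> = \<delta> ^ 3 * (1 - s) powr (-1/2)" using s by (simp add: powr_minus_divide powr_half_sqrt)
    also have "\<dots> \<le> \<delta> ^ 3 * (1 - s) powr (-3/4)" using s \<delta> by (intro mult_left_mono powr_mono') auto
    finally show "\<bar>R s\<bar> \<le> \<delta> ^ 3 * (1 - s) powr (-3/4)" .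
  qed
  ultimately show ?thesis by (simp add: integral_unique)
qed

text \<open>
  Replacing \<open>sine_drop\<close> by its mean value \<open>(1 - s\<^sup>2) / 4\<close> turns the integral into a multiple of \<open>C2\<close>;
  the error is the difference of two squares, one factor of which is small by \<open>sine_drop_average\<close>.
\<close>

lemma second_order_term:
  assumes p: "1 \<le> p" and \<alpha>: "1 \<le> \<alpha>"
  shows "\<bar>3 / 8 * (p + 1)\<^sup>2 * integral {0..1} (\<lambda>s. (sine_drop \<alpha> s)\<^sup>2 / power_drop p s powr (5/2)) - C2 p\<bar>
    \<le> 9 / 4 * (p + 1)\<^sup>2 * \<alpha> powr (-1/4)"
proof -
  define f where "f = (\<lambda>s. (sine_drop \<alpha> s)\<^sup>2 - 1 / 16 * (1 - s\<^sup>2)\<^sup>2)"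
  define M where "M = integral {0..1} (\<lambda>s. (1 - s\<^sup>2)\<^sup>2 / power_drop p s powr (5/2))"
  define N where "N = integral {0..1} (\<lambda>s. (sine_drop \<alpha> s)\<^sup>2 / power_drop p s powr (5/2))"
  have a0: "0 < \<alpha>" using \<alpha> by simp
  have H: "0 \<le> sine_drop \<alpha> s" "sine_drop \<alpha> s \<le> 1 - s" if "s \<in> {0..1}" for s
    using sine_drop_nonneg[OF a0, of s] sine_drop_le[OF a0, of s] that by auto
  have Hc: "continuous_on S (sine_drop \<alpha>)" for S by (rule continuous_on_sine_drop[OF a0])
  have "\<bar>f s\<bar> \<le> 3 / 2 * \<alpha> powr (-1/4) * (1 - s) powr (7/4)" if s: "s \<in> {0..<1}" for s
  proof -
    have "f s = (sine_drop \<alpha> s - (1 - s\<^sup>2) / 4) * (sine_drop \<alpha> s + (1 - s\<^sup>2) / 4)"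
      by (simp add: f_def field_simps power2_eq_square)
    moreover have "\<bar>sine_drop \<alpha> s + (1 - s\<^sup>2) / 4\<bar> \<le> 3 / 2 * (1 - s)"
      using H[of s] one_minus_square[of s] s unfolding abs_le_iff by auto argo+
    ultimately have "\<bar>f s\<bar> \<le> (\<alpha> powr (-1/4) * (1 - s) powr (3/4)) * (3 / 2 * (1 - s))"
      using sine_drop_average[OF \<alpha>, of s] s by (simp only: abs_mult) (intro mult_mono, auto)
    also have "\<dots> = 3 / 2 * \<alpha> powr (-1/4) * ((1 - s) powr (3/4) * (1 - s) powr 1)" using s by simp
    also have "(1 - s) powr (3/4) * (1 - s) powr 1 = (1 - s) powr (7/4)"
      by (subst powr_add[symmetric]) simp
    finally show ?thesis .
  qed
  moreover have "continuous_on {0..<1} f" unfolding f_def by (intro continuous_intros Hc)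
  ultimately have b: "\<bar>integral {0..1} (\<lambda>s. f s / power_drop p s powr (5/2))\<bar> \<le> 4 * (3 / 2 * \<alpha> powr (-1/4))"
    by (intro power_drop_quotient_integral(2)[OF p, where j = "7/4"]) auto
  have "((\<lambda>s. (sine_drop \<alpha> s)\<^sup>2 / power_drop p s powr (5/2) - 1 / 16 * ((1 - s\<^sup>2)\<^sup>2 / power_drop p s powr (5/2)))
     has_integral (N - 1 / 16 * M)) {0..1}"
    unfolding M_def N_def
  proof (intro has_integral_diff has_integral_mult_right integrable_integral)
    show "(\<lambda>s. (sine_drop \<alpha> s)\<^sup>2 / power_drop p s powr (5/2)) integrable_on {0..1}"
      by (rule power_drop_quotient_integral(1)[OF p _, where C = 1 and j = 2])
         (use H in \<open>auto intro!: continuous_intros Hc power_mono\<close>)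
    show "(\<lambda>s. (1 - s\<^sup>2)\<^sup>2 / power_drop p s powr (5/2)) integrable_on {0..1}"
    proof (rule power_drop_quotient_integral(1)[OF p _, where C = 4 and j = 2])
      show "\<bar>(1 - s\<^sup>2)\<^sup>2\<bar> \<le> 4 * (1 - s) powr 2" if "s \<in> {0..<1}" for s :: real
      proof -
        have "(1 - s\<^sup>2)\<^sup>2 \<le> (2 * (1 - s))\<^sup>2"
          using one_minus_square[of s] that by (intro power_mono) auto
        then show ?thesis using that by (simp only: power_mult_distrib) simp
      qed
    qed (auto intro!: continuous_intros)
  qed
  also have "(\<lambda>s. (sine_drop \<alpha> s)\<^sup>2 / power_drop p s powr (5/2) - 1 / 16 * ((1 - s\<^sup>2)\<^sup>2 / power_drop p s powr (5/2)))
     = (\<lambda>s. f s / power_drop p s powr (5/2))"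
    by (simp add: f_def diff_divide_distrib)
  finally have NM: "\<bar>N - 1 / 16 * M\<bar> \<le> 6 * \<alpha> powr (-1/4)"
    using b by (simp add: integral_unique)
  have "C2 p = 3 / 8 * (p + 1)\<^sup>2 * (1 / 16 * M)" by (simp add: C2_def M_def power_drop_def)
  then have "3 / 8 * (p + 1)\<^sup>2 * N - C2 p = 3 / 8 * (p + 1)\<^sup>2 * (N - 1 / 16 * M)"
    by (simp add: algebra_simps)
  then have "\<bar>3 / 8 * (p + 1)\<^sup>2 * N - C2 p\<bar> = 3 / 8 * (p + 1)\<^sup>2 * \<bar>N - 1 / 16 * M\<bar>"
    by (simp only: abs_mult) simp
  also have "\<dots> \<le> 3 / 8 * (p + 1)\<^sup>2 * (6 * \<alpha> powr (-1/4))"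
    using NM by (intro mult_left_mono) auto
  finally show ?thesis unfolding N_def by simp
qed

section \<open>The asymptotic expansion\<close>

theorem theorem1p1:
  fixes p :: real and \<mu> :: "real \<Rightarrow> real"
  assumes "p > 2"
    and "\<And>\<alpha>. \<alpha> > 0 \<Longrightarrow> \<mu> \<alpha> > 0 \<and> (\<exists>v. is_solution p (\<mu> \<alpha>) v \<and> sup_norm v = \<alpha>)"
  shows "\<exists>r. r \<in> o[at_top](\<lambda>\<alpha>. \<alpha> powr (2 * (1 - p))) \<and>
    (\<forall>\<^sub>F \<alpha> in at_top. \<mu> \<alpha> = 2 * (p + 1) * \<alpha> powr (1 - p) *
       (C0 p
        + (C1 p + 1/2 * C11 p \<alpha>) * \<alpha> powr (1 - p)
        + 1/2 * (C12 p \<alpha> + C21 p \<alpha>) * \<alpha> powr (- p)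
        + 1/2 * C22 p \<alpha> * \<alpha> powr (- (p + 1))
        + (C2 p + C3 p \<alpha>) * \<alpha> powr (2 * (1 - p))
        + r \<alpha>)\<^sup>2)"
proof -
  have p: "1 \<le> p" using assms(1) by simp
  define J where "J = (\<lambda>\<alpha>. integral {0..1} (\<lambda>s. 1 / sqrt (power_drop p s + (p + 1) * \<alpha> powr (1 - p) * sine_drop \<alpha> s)))"
  define r where "r = (\<lambda>\<alpha>. J \<alpha> - (C0 p
        + (C1 p + 1/2 * C11 p \<alpha>) * \<alpha> powr (1 - p)
        + 1/2 * (C12 p \<alpha> + C21 p \<alpha>) * \<alpha> powr (- p)
        + 1/2 * C22 p \<alpha> * \<alpha> powr (- (p + 1))
        + (C2 p + C3 p \<alpha>) * \<alpha> powr (2 * (1 - p))))"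
  have bound: "\<bar>r \<alpha>\<bar> \<le> (4 * (p + 1) ^ 3 * \<alpha> powr (1 - p) + 3 * (p + 1)\<^sup>2 * \<alpha> powr (-1/4))
      * \<alpha> powr (2 * (1 - p))" if \<alpha>: "1 \<le> \<alpha>" for \<alpha>
  proof -
    have a0: "0 < \<alpha>" using \<alpha> by simp
    define \<epsilon> where "\<epsilon> = \<alpha> powr (1 - p)"
    define N where "N = integral {0..1} (\<lambda>s. (sine_drop \<alpha> s)\<^sup>2 / power_drop p s powr (5/2))"
    define L where "L = integral {0..1} (\<lambda>s. sine_drop \<alpha> s / power_drop p s powr (3/2))"
    have \<epsilon>: "0 \<le> \<epsilon>" by (simp add: \<epsilon>_def)
    have e2: "\<alpha> powr (2 * (1 - p)) = \<epsilon>\<^sup>2"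
      using a0 by (simp add: \<epsilon>_def powr_power mult.commute)
    have "\<bar>J \<alpha> - (C0 p - (p + 1) * \<epsilon> / 2 * L + 3 / 8 * ((p + 1) * \<epsilon>)\<^sup>2 * N)\<bar>
        \<le> 4 * ((p + 1) * \<epsilon>) ^ 3"
      unfolding J_def L_def N_def \<epsilon>_def
      by (rule time_integral_expansion[OF p a0]) (use p in simp)
    moreover have "r \<alpha> = (J \<alpha> - (C0 p - (p + 1) * \<epsilon> / 2 * L + 3 / 8 * ((p + 1) * \<epsilon>)\<^sup>2 * N))
        + (3 / 8 * (p + 1)\<^sup>2 * N - C2 p) * \<epsilon>\<^sup>2 - C3 p \<alpha> * \<epsilon>\<^sup>2"
    proof -
      have "r \<alpha> = J \<alpha> - (C0 p - (p + 1) * \<epsilon> / 2 * L + (C2 p + C3 p \<alpha>) * \<epsilon>\<^sup>2)"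
        unfolding r_def e2 using first_order_term[OF p a0, folded \<epsilon>_def L_def]
        unfolding \<epsilon>_def[symmetric] by (simp add: algebra_simps)
      then show ?thesis unfolding power_mult_distrib by (simp add: algebra_simps)
    qed
    moreover have "\<bar>(3 / 8 * (p + 1)\<^sup>2 * N - C2 p) * \<epsilon>\<^sup>2\<bar> \<le> 9 / 4 * (p + 1)\<^sup>2 * \<alpha> powr (-1/4) * \<epsilon>\<^sup>2"
      unfolding abs_mult abs_power2
      by (intro mult_right_mono second_order_term[OF p \<alpha>, folded N_def]) simp
    moreover have "\<bar>C3 p \<alpha> * \<epsilon>\<^sup>2\<bar> \<le> 3/4 * (p + 1)\<^sup>2 * \<alpha> powr (-1/4) * \<epsilon>\<^sup>2"
      unfolding abs_mult abs_power2 by (intro mult_right_mono C3_small[OF p \<alpha>]) simp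
    ultimately have "\<bar>r \<alpha>\<bar> \<le> 4 * ((p + 1) * \<epsilon>) ^ 3 + 9 / 4 * (p + 1)\<^sup>2 * \<alpha> powr (-1/4) * \<epsilon>\<^sup>2
        + 3/4 * (p + 1)\<^sup>2 * \<alpha> powr (-1/4) * \<epsilon>\<^sup>2" by linarith
    also have "\<dots> = (4 * (p + 1) ^ 3 * \<epsilon> + 3 * (p + 1)\<^sup>2 * \<alpha> powr (-1/4)) * \<epsilon>\<^sup>2"
      unfolding power_mult_distrib
      by (simp add: distrib_right power2_eq_square[of \<epsilon>]
          power3_eq_cube[of \<epsilon>])
    finally show ?thesis unfolding e2 unfolding \<epsilon>_def .
  qed
  have "((\<lambda>\<alpha>. r \<alpha> / \<alpha> powr (2 * (1 - p))) \<longlongrightarrow> 0) at_top"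
  proof (rule Lim_null_comparison)
    show "\<forall>\<^sub>F \<alpha> in at_top. norm (r \<alpha> / \<alpha> powr (2 * (1 - p)))
        \<le> 4 * (p + 1) ^ 3 * \<alpha> powr (1 - p) + 3 * (p + 1)\<^sup>2 * \<alpha> powr (-1/4)"
      using eventually_ge_at_top[of 1]
    proof eventually_elim
      case (elim \<alpha>)
      then show ?case using bound[OF elim] by (simp add: abs_divide pos_divide_le_eq)
    qed
    have "((\<lambda>\<alpha>::real. \<alpha> powr q) \<longlongrightarrow> 0) at_top" if "q < 0" for q
      by (rule tendsto_neg_powr[OF that filterlim_ident])
    then show "((\<lambda>\<alpha>. 4 * (p + 1) ^ 3 * \<alpha> powr (1 - p) + 3 * (p + 1)\<^sup>2 * \<alpha> powr (-1/4)) \<longlongrightarrow> 0) at_top"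
      using assms(1) by (intro tendsto_add_zero tendsto_mult_right_zero) simp_all
  qed
  then have "r \<in> o[at_top](\<lambda>\<alpha>. \<alpha> powr (2 * (1 - p)))"
  proof (rule smalloI_tendsto)
    show "\<forall>\<^sub>F \<alpha> in at_top. \<alpha> powr (2 * (1 - p)) \<noteq> 0"
      using eventually_gt_at_top[of 0] by eventually_elim simp
  qed
  moreover have \<mu>: "\<mu> \<alpha> = 2 * (p + 1) * \<alpha> powr (1 - p) * (J \<alpha>)\<^sup>2" if \<alpha>: "0 < \<alpha>" for \<alpha>
  proof -
    obtain v where "is_solution p (\<mu> \<alpha>) v" "sup_norm v = \<alpha>" and pos: "0 < \<mu> \<alpha>"
      using assms(2)[OF \<alpha>] by blast
    then show ?thesis unfolding J_def by (intro time_map[OF p pos \<alpha>])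
  qed
  have "\<forall>\<^sub>F \<alpha> in at_top. \<mu> \<alpha> = 2 * (p + 1) * \<alpha> powr (1 - p) *
       (C0 p
        + (C1 p + 1/2 * C11 p \<alpha>) * \<alpha> powr (1 - p)
        + 1/2 * (C12 p \<alpha> + C21 p \<alpha>) * \<alpha> powr (- p)
        + 1/2 * C22 p \<alpha> * \<alpha> powr (- (p + 1))
        + (C2 p + C3 p \<alpha>) * \<alpha> powr (2 * (1 - p))
        + r \<alpha>)\<^sup>2"
    using eventually_gt_at_top[of 0]
  proof eventually_elim
    case (elim \<alpha>)
    show ?case using \<mu>[OF elim] by (simp add: r_def)
  qed
  ultimately show ?thesis by blast
qed

end
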